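(* Let $\boldsymbol{\beta}=(\beta_1,\dots,\beta_p)$ be an alternate base with Property (PP), and let $\delta=\prod_{i=1}^p\beta_i$. Then $\delta$ is a Pisot unit or a Salem unit, $\beta_i\in\mathbb{Q}(\delta)$ for every $i=1,\dots,p$, and for every non-identical field embedding $\psi:\mathbb{Q}(\delta)\to\mathbb{C}$ the vector $(\psi(\beta_1),\dots,\psi(\beta_p))$ is not positive (i.e. it is not the case that all $\psi(\beta_i)$ are positive real numbers).
   Context: An alternate base is a $p$-tuple $\boldsymbol{\beta}=(\beta_1,\dots,\beta_p)$ of real numbers $\beta_i>1$, identified with the purely periodic sequence $(\beta_k)_{k\ge1}$, $\beta_{k+p}=\beta_k$. For $x\in[0,1)$ the $\boldsymbol{\beta}$-expansion $d_{\boldsymbol{\beta}}(x)=a_1a_2\cdots$ is given by the greedy algorithm $r_0=x$, $a_{k+1}=\lfloor\beta_{k+1}r_k\rfloor$, $r_{k+1}=\beta_{k+1}r_k-a_{k+1}$, so $x=\sum_{k\ge1}a_k/\prod_{i=1}^k\beta_i$. The base $\boldsymbol{\beta}$ has Property (PP) (pure periodicity property) if there exists $\gamma>0$ such that $d_{\boldsymbol{\beta}}(x)$ is purely periodic for every $x\in[0,\gamma)\cap\mathbb{Q}$. A Pisot (resp. Salem) unit is a Pisot (resp. Salem) number that is an algebraic unit; a Pisot number is a real algebraic integer $>1$ whose other conjugates all have modulus $<1$, a Salem number is a real algebraic integer $>1$ whose other conjugates all have modulus $\le1$ with at least one of modulus $1$. *)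

theory Defs
  imports "HOL-Analysis.Analysis" "HOL-Computational_Algebra.Polynomial"
begin

text \<open>An alternate base of length p is given by beta :: nat => real, with
  beta 1, ..., beta p the base; it is extended periodically.\<close>

definition alt_base :: "nat \<Rightarrow> (nat \<Rightarrow> real) \<Rightarrow> bool" where
  "alt_base p beta \<longleftrightarrow> p \<ge> 1 \<and> (\<forall>i\<in>{1..p}. beta i > 1)"

definition beta_per :: "nat \<Rightarrow> (nat \<Rightarrow> real) \<Rightarrow> nat \<Rightarrow> real" where
  "beta_per p beta k = beta (((k - 1) mod p) + 1)"

fun greedy_rem :: "nat \<Rightarrow> (nat \<Rightarrow> real) \<Rightarrow> real \<Rightarrow> nat \<Rightarrow> real" where
  "greedy_rem p beta x 0 = x"
| "greedy_rem p beta x (Suc k) =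
     beta_per p beta (Suc k) * greedy_rem p beta x k
     - of_int \<lfloor>beta_per p beta (Suc k) * greedy_rem p beta x k\<rfloor>"

definition greedy_digit :: "nat \<Rightarrow> (nat \<Rightarrow> real) \<Rightarrow> real \<Rightarrow> nat \<Rightarrow> int" where
  "greedy_digit p beta x k = \<lfloor>beta_per p beta k * greedy_rem p beta x (k - 1)\<rfloor>"

definition purely_periodic_expansion :: "nat \<Rightarrow> (nat \<Rightarrow> real) \<Rightarrow> real \<Rightarrow> bool" where
  "purely_periodic_expansion p beta x \<longleftrightarrow>
     (\<exists>n>0. \<forall>k\<ge>1. greedy_digit p beta x (k + n) = greedy_digit p beta x k)"

definition property_PP :: "nat \<Rightarrow> (nat \<Rightarrow> real) \<Rightarrow> bool" where
  "property_PP p beta \<longleftrightarrow>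
     (\<exists>\<gamma>>0. \<forall>x\<in>{0..<\<gamma>} \<inter> \<rat>. purely_periodic_expansion p beta x)"

definition algebraic_integer :: "complex \<Rightarrow> bool" where
  "algebraic_integer z \<longleftrightarrow>
     (\<exists>q :: int poly. lead_coeff q = 1 \<and> poly (map_poly of_int q) z = 0)"

definition algebraic_unit :: "complex \<Rightarrow> bool" where
  "algebraic_unit z \<longleftrightarrow> z \<noteq> 0 \<and> algebraic_integer z \<and> algebraic_integer (inverse z)"

definition is_min_poly_rat :: "complex \<Rightarrow> rat poly \<Rightarrow> bool" where
  "is_min_poly_rat z q \<longleftrightarrow> lead_coeff q = 1 \<and> poly (map_poly of_rat q) z = 0 \<and>
     (\<forall>r :: rat poly. r \<noteq> 0 \<and> poly (map_poly of_rat r) z = 0 \<longrightarrow> degree q \<le> degree r)"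

definition conjugates :: "complex \<Rightarrow> complex set" where
  "conjugates z = {w. \<exists>q. is_min_poly_rat z q \<and> poly (map_poly of_rat q) w = 0}"

definition pisot :: "real \<Rightarrow> bool" where
  "pisot x \<longleftrightarrow> x > 1 \<and> algebraic_integer (complex_of_real x) \<and>
     (\<forall>w\<in>conjugates (complex_of_real x). w \<noteq> complex_of_real x \<longrightarrow> cmod w < 1)"

definition salem :: "real \<Rightarrow> bool" where
  "salem x \<longleftrightarrow> x > 1 \<and> algebraic_integer (complex_of_real x) \<and>
     (\<forall>w\<in>conjugates (complex_of_real x). w \<noteq> complex_of_real x \<longrightarrow> cmod w \<le> 1) \<and>
     (\<exists>w\<in>conjugates (complex_of_real x). w \<noteq> complex_of_real x \<and> cmod w = 1)"

definition pisot_unit :: "real \<Rightarrow> bool" where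
  "pisot_unit x \<longleftrightarrow> pisot x \<and> algebraic_unit (complex_of_real x)"

definition salem_unit :: "real \<Rightarrow> bool" where
  "salem_unit x \<longleftrightarrow> salem x \<and> algebraic_unit (complex_of_real x)"

definition gen_subfield :: "complex set \<Rightarrow> complex set" where
  "gen_subfield S = \<Inter>{K. S \<subseteq> K \<and> 1 \<in> K \<and>
       (\<forall>a\<in>K. \<forall>b\<in>K. a + b \<in> K \<and> a * b \<in> K \<and> - a \<in> K \<and> inverse a \<in> K)}"

definition rat_adjoin :: "complex \<Rightarrow> complex set" where
  "rat_adjoin z = gen_subfield {z}"

definition field_embedding :: "complex set \<Rightarrow> (complex \<Rightarrow> complex) \<Rightarrow> bool" where
  "field_embedding K \<psi> \<longleftrightarrow> \<psi> 1 = 1 \<and>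
     (\<forall>a\<in>K. \<forall>b\<in>K. \<psi> (a + b) = \<psi> a + \<psi> b \<and> \<psi> (a * b) = \<psi> a * \<psi> b)"

end

theory Submission
  imports Defs "Jordan_Normal_Form.Char_Poly" "HOL-Computational_Algebra.Field_as_Ring"
begin

text \<open>
  A purely periodic expansion of \<open>x\<close> with period \<open>m p\<close> is a relation
  \<open>x (1 - \<delta>\<^sup>-\<^sup>m) = (\<Sum>t < m p. a\<^sub>t / P\<^sub>t\<^sub>+\<^sub>1)\<close> with \<open>P\<^sub>k = \<beta>\<^sub>1 \<cdots> \<beta>\<^sub>k\<close>. Rationals slightly above
  \<open>1 / P\<^sub>k\<close> start with a single digit 1 followed by many zeros, so these relations determine the
  weights: if \<open>v\<^sub>t\<^sub>+\<^sub>p = y v\<^sub>t\<close> with \<open>|y| < 1\<close> and the digits of every small rational \<open>x\<close> satisfy the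
  relation with weights \<open>v\<close> and value \<open>\<Lambda> x\<close>, then \<open>v\<^sub>t = \<Lambda> / P\<^sub>t\<^sub>+\<^sub>1\<close> for large \<open>t\<close>.
  With \<open>\<Lambda> = 0\<close>, every \<open>\<rat>(\<delta>)\<close>-linear functional annihilating \<open>\<rat>(\<delta>)\<close> annihilates all \<open>1 / P\<^sub>t\<close>, whence
  \<open>\<beta>\<^sub>i \<in> \<rat>(\<delta>)\<close>. With \<open>\<Lambda> = 1\<close>, an embedding \<open>\<psi>\<close> with \<open>|\<psi>(\<delta>)| > 1\<close> fixes \<open>\<delta>\<close>; hence the other
  conjugates of \<open>\<delta>\<close> have modulus at most 1. If moreover all \<open>\<psi>(\<beta>\<^sub>i)\<close> are positive for a
  nonidentical \<open>\<psi>\<close>, then in the image of the relation under \<open>\<psi>\<close> the left side is at most 0 and the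
  right side is positive.

  Integrality: subtracting multiples of the relation for \<open>1 / Q\<close> from those for \<open>c / Q\<close> close to
  \<open>1 / P\<^sub>k\<close> exhibits a finitely generated \<open>\<int>\<close>-module spanned by weights and stable under \<open>\<delta>\<close>.
  The unit property comes from \<open>1 / Q\<close> with \<open>Q\<close> highly divisible.
\<close>

section \<open>Greedy digits\<close>

locale alternate_base =
  fixes p :: nat and beta :: "nat \<Rightarrow> real"
  assumes alt_base: "alt_base p beta"
begin

text \<open>Digits and bases are indexed from \<open>0\<close> here, so that \<open>dig x k\<close> has weight \<open>1 / P (Suc k)\<close>.\<close>

definition b :: "nat \<Rightarrow> real" where
  "b k = beta_per p beta (Suc k)"

definition P :: "nat \<Rightarrow> real" where
  "P k = (\<Prod>i<k. b i)"

abbreviation \<delta> :: real where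
  "\<delta> \<equiv> P p"

abbreviation rm :: "real \<Rightarrow> nat \<Rightarrow> real" where
  "rm x k \<equiv> greedy_rem p beta x k"

definition dig :: "real \<Rightarrow> nat \<Rightarrow> int" where
  "dig x k = \<lfloor>b k * rm x k\<rfloor>"

lemma p_pos: "p > 0"
  using alt_base by (auto simp: alt_base_def)

lemma b_eq: "b k = beta (k mod p + 1)"
  by (simp add: b_def beta_per_def)

lemma b_gt_1: "b k > 1"
  using alt_base p_pos by (auto simp: alt_base_def b_eq Suc_le_eq)

lemma b_periodic [simp]: "b (k + p) = b k"
  by (simp add: b_eq)

lemma P_0 [simp]: "P 0 = 1" and P_Suc [simp]: "P (Suc k) = b k * P k"
  by (simp_all add: P_def mult.commute)

lemma P_pos [simp]: "P k > 0"
  unfolding P_def by (intro prod_pos) (use b_gt_1 in \<open>force intro: order.strict_trans[of 0 1]\<close>)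

lemma P_nonzero [simp]: "P k \<noteq> 0"
  using P_pos[of k] by linarith

lemma P_add_p: "P (k + p) = \<delta> * P k"
  by (induction k) (simp_all add: mult_ac)

lemma P_add_mult_p: "P (k + m * p) = \<delta> ^ m * P k"
proof (induction m)
  case (Suc m)
  have "P (k + Suc m * p) = P ((k + m * p) + p)" by (simp add: algebra_simps)
  then show ?case using Suc P_add_p by simp
qed simp

lemma P_mult_p: "P (m * p) = \<delta> ^ m"
  using P_add_mult_p[of 0 m] by simp

lemma strict_mono_P: "strict_mono P"
  by (rule strict_monoI_Suc) (use b_gt_1 in simp)

lemma P_mono: "i \<le> j \<Longrightarrow> P i \<le> P j"
  using strict_mono_P by (simp add: strict_mono_less_eq)

lemma delta_gt_1: "\<delta> > 1"
  using strict_monoD[OF strict_mono_P p_pos] by simp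

lemma delta_eq: "\<delta> = (\<Prod>i=1..p. beta i)"
proof -
  have "\<delta> = (\<Prod>i<p. beta (i + 1))"
    unfolding P_def by (intro prod.cong) (auto simp: b_eq)
  also have "\<dots> = (\<Prod>i=1..p. beta i)"
    by (rule prod.reindex_bij_witness[of _ "\<lambda>i. i - 1" "\<lambda>i. i + 1"]) auto
  finally show ?thesis .
qed

lemma P_unbounded: "\<exists>k. C < P k"
proof -
  obtain m where "C < \<delta> ^ m" using real_arch_pow[OF delta_gt_1] by blast
  then show ?thesis using P_mult_p by metis
qed

lemma P_tail_unbounded: "\<exists>N. \<forall>k\<ge>N. C < P k"
  using P_unbounded[of C] P_mono by (meson less_le_trans)

lemma b_bounded: "\<exists>B>0. \<forall>k. b k \<le> B"
proof (intro exI[of _ "Max (b ` {..<p})"] conjI allI)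
  have le: "b k \<le> Max (b ` {..<p})" for k
  proof -
    have "b k = b (k mod p)" by (simp add: b_eq)
    moreover have "k mod p < p" using p_pos by simp
    ultimately show ?thesis by (auto intro!: Max_ge)
  qed
  then show "b k \<le> Max (b ` {..<p})" for k .
  show "Max (b ` {..<p}) > 0" using le[of 0] b_gt_1[of 0] by linarith
qed

lemma rm_Suc: "rm x (Suc k) = b k * rm x k - of_int (dig x k)"
  by (simp add: b_def dig_def)

declare greedy_rem.simps(2) [simp del]

lemma rm_bounds:
  assumes "x \<in> {0..<1}"
  shows "rm x k \<in> {0..<1}"
proof (cases k)
  case (Suc j)
  show ?thesis unfolding Suc rm_Suc dig_def
    using floor_correct[of "b j * rm x j"] by (simp, linarith)
qed (use assms in simp)

lemma dig_nonneg: "x \<in> {0..<1} \<Longrightarrow> dig x k \<ge> 0"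
  unfolding dig_def using rm_bounds[of x k] b_gt_1[of k] by auto

lemma dig_le: "x \<in> {0..<1} \<Longrightarrow> of_int (dig x k) \<le> b k"
proof -
  assume "x \<in> {0..<1}"
  then have "b k * rm x k \<le> b k * 1"
    using rm_bounds[of x k] b_gt_1[of k] by (intro mult_left_mono) auto
  then show ?thesis unfolding dig_def using of_int_floor_le[of "b k * rm x k"] by linarith
qed

text \<open>Each step of the recursion splits \<open>rm x n / P n\<close> into the next digit term
  and the next tail, so the identity is exact for every \<open>n\<close> and involves no
  limit.\<close>

lemma expansion: "x = (\<Sum>t<n. of_int (dig x t) / P (Suc t)) + rm x n / P n"
proof (induction n)
  case (Suc n)
  have "b n \<noteq> 0" using b_gt_1[of n] by simp
  then have "rm x n / P n = of_int (dig x n) / P (Suc n) + rm x (Suc n) / P (Suc n)"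
    by (simp add: rm_Suc field_simps)
  then show ?case using Suc by simp
qed simp

section \<open>Periodic digit sequences\<close>

definition has_period :: "real \<Rightarrow> nat \<Rightarrow> bool" where
  "has_period x n \<longleftrightarrow> (\<forall>k. dig x (k + n) = dig x k)"

lemma has_period_mult: "has_period x n \<Longrightarrow> has_period x (m * n)"
proof (induction m)
  case (Suc m)
  have "dig x (k + Suc m * n) = dig x k" for k
  proof -
    have "dig x (k + Suc m * n) = dig x ((k + m * n) + n)" by (simp add: algebra_simps)
    then show ?thesis using Suc by (simp add: has_period_def)
  qed
  then show ?case by (simp add: has_period_def)
qed (simp add: has_period_def)

lemma purely_periodic_imp_has_period:
  assumes "purely_periodic_expansion p beta x"
  obtains n where "n > 0" "has_period x n"
proof -
  obtain n where n: "n > 0" "\<forall>k\<ge>1. greedy_digit p beta x (k + n) = greedy_digit p beta x k"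
    using assms by (auto simp: purely_periodic_expansion_def)
  have "dig x k = greedy_digit p beta x (Suc k)" for k
    by (simp add: dig_def greedy_digit_def b_def)
  then have "has_period x n" using n(2)[rule_format, of "Suc k" for k] by (simp add: has_period_def)
  with n(1) that show ?thesis by blast
qed

text \<open>Two orbits with equal digits separate by the factor \<open>P k\<close>, hence coincide as
  remainders stay in \<open>[0, 1)\<close>.\<close>

lemma rm_period:
  assumes x: "x \<in> {0..<1}" and per: "has_period x (m * p)"
  shows "rm x (m * p) = x"
proof (rule ccontr)
  let ?n = "m * p"
  assume ne: "rm x ?n \<noteq> x"
  have diff: "rm x (k + ?n) - rm x k = P k * (rm x ?n - x)" for k
  proof (induction k)
    case (Suc k)
    have "b (k + ?n) = b k" by (simp add: b_eq)
    then have "rm x (Suc k + ?n) - rm x (Suc k) = b k * (rm x (k + ?n) - rm x k)"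
      using per by (simp add: rm_Suc has_period_def algebra_simps)
    then show ?case using Suc by simp
  qed simp
  obtain k where "1 / \<bar>rm x ?n - x\<bar> < P k" using P_unbounded by blast
  with ne have "1 < P k * \<bar>rm x ?n - x\<bar>" by (simp add: field_simps)
  also have "\<dots> = \<bar>rm x (k + ?n) - rm x k\<bar>" using diff by (simp add: abs_mult less_imp_le)
  also have "\<dots> < 1" using rm_bounds[OF x, of "k + ?n"] rm_bounds[OF x, of k] by auto
  finally show False .
qed

text \<open>After a full period the remainder is \<open>x\<close> again, and
  \<open>P (m * p)\<close> is \<open>\<delta> ^ m\<close>. So the tail in \<open>expansion\<close>
  equals \<open>x / \<delta> ^ m\<close> and moves to the left side.\<close>

lemma periodic_expansion:
  assumes "x \<in> {0..<1}" and "has_period x (m * p)"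
  shows "x * (1 - 1 / \<delta> ^ m) = (\<Sum>t<m * p. of_int (dig x t) / P (Suc t))"
  using expansion[of x "m * p"] rm_period[OF assms] by (simp add: P_mult_p algebra_simps)

section \<open>Expansions with a prescribed initial block of digits\<close>

lemma dig_initial_zero:
  assumes "0 \<le> x" and "P M * x < 1"
  shows "t \<le> M \<Longrightarrow> rm x t = P t * x" and "t < M \<Longrightarrow> dig x t = 0"
proof -
  have zero: "dig x t = 0" if "t < M" "rm x t = P t * x" for t
  proof -
    have "P (Suc t) * x \<le> P M * x" using that assms by (intro mult_right_mono P_mono) auto
    then show ?thesis using that assms b_gt_1[of t]
      by (simp add: dig_def floor_eq_iff mult.assoc[symmetric] zero_le_mult_iff less_imp_le)
  qed
  have rm: "rm x t = P t * x" if "t \<le> M" for t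
    using that
  proof (induction t)
    case (Suc t)
    then show ?case using zero[of t] by (simp add: rm_Suc)
  qed simp
  show "t \<le> M \<Longrightarrow> rm x t = P t * x" "t < M \<Longrightarrow> dig x t = 0"
    using rm zero by auto
qed

text \<open>The bound on \<open>P k * x\<close> makes the digits before \<open>k\<close> zero. Digit
  \<open>k\<close> then removes the summand 1 from \<open>P (Suc k) * ?y + 1\<close>, where
  \<open>?y\<close> is the excess of \<open>x\<close> over \<open>1 / P (Suc k)\<close>, and the
  later remainders \<open>P s * ?y\<close> stay below 1 up to \<open>M\<close>.\<close>

lemma dig_near_inverse_P:
  assumes "1 / P (Suc k) \<le> x" and "P k * x < 1"
    and "P M * (x - 1 / P (Suc k)) < 1" and "k < M" and "t < M"
  shows "dig x t = of_bool (t = k)"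
proof -
  let ?y = "x - 1 / P (Suc k)"
  have y0: "?y \<ge> 0" using assms by simp
  have x0: "x \<ge> 0" using assms(1) P_pos[of "Suc k"] by (meson divide_nonneg_pos order_trans zero_le_one)
  have eq: "b k * (P k * x) = P (Suc k) * ?y + 1"
    using P_nonzero[of "Suc k"] by (simp add: field_simps del: P_Suc) (simp add: mult_ac)
  have small: "P s * ?y < 1" if "s \<le> M" for s
    using mult_right_mono[OF P_mono[OF that] y0] assms(3) by linarith
  have digk: "dig x k = 1"
    using dig_initial_zero(1)[OF x0 assms(2), of k] eq small[of "Suc k"] assms(4) y0
    by (simp add: dig_def floor_eq_iff zero_le_mult_iff less_imp_le del: P_Suc)
  have zero: "dig x s = 0" if "s < M" "rm x s = P s * ?y" for s
    using that small[of "Suc s"] y0 b_gt_1[of s]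
    by (simp add: dig_def floor_eq_iff mult.assoc[symmetric] zero_le_mult_iff less_imp_le)
  have rm: "Suc k + s \<le> M \<Longrightarrow> rm x (Suc k + s) = P (Suc k + s) * ?y" for s
  proof (induction s)
    case 0
    show ?case
      using dig_initial_zero(1)[OF x0 assms(2), of k] eq digk by (simp add: rm_Suc del: P_Suc)
  next
    case (Suc s)
    then show ?case using zero[of "Suc k + s"] by (simp add: rm_Suc)
  qed
  consider "t < k" | "t = k" | s where "t = Suc k + s"
    by (metis less_iff_Suc_add linorder_neqE_nat add_Suc_right add_Suc)
  then show ?thesis
  proof cases
    case 1
    then show ?thesis using dig_initial_zero(2)[OF x0 assms(2)] by simp
  next
    case 3
    then show ?thesis using rm[of s] zero[of t] assms(5) by simp
  qed (simp add: digk)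
qed

lemma single_digit_right_of_inverse_P:
  "\<exists>\<eta>>0. \<forall>x. 1 / P (Suc k) \<le> x \<longrightarrow> x < 1 / P (Suc k) + \<eta> \<longrightarrow> (\<forall>t<M. dig x t = of_bool (t = k))"
proof -
  \<comment> \<open>The maximum ensures \<open>k < M'\<close>. In \<eta>, the first bound keeps the
    digits after \<open>k\<close> zero, the second one those before \<open>k\<close>.\<close>
  define M' where "M' = max M (Suc k)"
  define \<eta> where "\<eta> = min (1 / P M') (1 / P k - 1 / P (Suc k))"
  have "P k < P (Suc k)" using strict_mono_P by (simp add: strict_mono_less del: P_Suc)
  then have pos: "\<eta> > 0" by (simp add: \<eta>_def frac_less2 del: P_Suc)
  have "dig x t = of_bool (t = k)" if "1 / P (Suc k) \<le> x" "x < 1 / P (Suc k) + \<eta>" "t < M" for x t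
  proof (rule dig_near_inverse_P[of k x M'])
    have "x < 1 / P k" "x - 1 / P (Suc k) < 1 / P M'" using that by (auto simp: \<eta>_def)
    then show "P k * x < 1" "P M' * (x - 1 / P (Suc k)) < 1"
      by (simp_all add: field_simps del: P_Suc)
  qed (use that in \<open>auto simp: M'_def\<close>)
  with pos show ?thesis by blast
qed

end

section \<open>Subfields of the complex numbers and their embeddings\<close>

text \<open>This is the closure condition in \<open>gen_subfield\<close>, so
  \<open>rat_adjoin z\<close> is the least such set containing \<open>z\<close>. As
  \<open>inverse 0 = 0\<close>, closure under inverses needs no exception.\<close>

definition complex_subfield :: "complex set \<Rightarrow> bool" where
  "complex_subfield K \<longleftrightarrow> 1 \<in> K \<and>
     (\<forall>a\<in>K. \<forall>b\<in>K. a + b \<in> K \<and> a * b \<in> K \<and> - a \<in> K \<and> inverse a \<in> K)"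

context
  fixes K :: "complex set"
  assumes K: "complex_subfield K"
begin

lemma complex_subfield_1: "1 \<in> K"
  using K by (simp add: complex_subfield_def)

lemma complex_subfield_add: "a \<in> K \<Longrightarrow> b \<in> K \<Longrightarrow> a + b \<in> K"
  and complex_subfield_mult: "a \<in> K \<Longrightarrow> b \<in> K \<Longrightarrow> a * b \<in> K"
  and complex_subfield_uminus: "a \<in> K \<Longrightarrow> - a \<in> K"
  and complex_subfield_inverse: "a \<in> K \<Longrightarrow> inverse a \<in> K"
  using K unfolding complex_subfield_def by blast+

lemma complex_subfield_diff: "a \<in> K \<Longrightarrow> b \<in> K \<Longrightarrow> a - b \<in> K"
  using complex_subfield_add[of a "- b"] complex_subfield_uminus by simp

lemma complex_subfield_divide: "a \<in> K \<Longrightarrow> b \<in> K \<Longrightarrow> a / b \<in> K"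
  using complex_subfield_mult[of a "inverse b"] complex_subfield_inverse
  by (simp add: divide_inverse)

lemma complex_subfield_0: "0 \<in> K"
  using complex_subfield_diff[OF complex_subfield_1 complex_subfield_1] by simp

lemma complex_subfield_power: "a \<in> K \<Longrightarrow> a ^ n \<in> K"
  by (induction n) (auto intro: complex_subfield_1 complex_subfield_mult)

lemma complex_subfield_sum: "(\<And>i. i \<in> I \<Longrightarrow> f i \<in> K) \<Longrightarrow> sum f I \<in> K"
  by (induction I rule: infinite_finite_induct)
    (auto intro: complex_subfield_0 complex_subfield_add)

lemma complex_subfield_prod: "(\<And>i. i \<in> I \<Longrightarrow> f i \<in> K) \<Longrightarrow> prod f I \<in> K"
  by (induction I rule: infinite_finite_induct)
    (auto intro: complex_subfield_1 complex_subfield_mult)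

lemma complex_subfield_of_nat: "of_nat n \<in> K"
  by (induction n) (auto intro: complex_subfield_0 complex_subfield_1 complex_subfield_add)

lemma complex_subfield_of_int: "of_int n \<in> K"
  by (cases n rule: int_cases2) (auto intro: complex_subfield_of_nat complex_subfield_uminus)

lemma complex_subfield_Rats:
  assumes "a \<in> \<rat>"
  shows "a \<in> K"
proof -
  obtain m n where "a = of_int m / of_int n" using assms by (auto elim: Rats_cases')
  then show ?thesis by (auto intro: complex_subfield_divide complex_subfield_of_int)
qed

text \<open>The vector \<open>v\<close> encodes a functional, linear over \<open>K\<close>, that annihilates \<open>K\<close> but not all \<open>g i\<close>.\<close>

lemma annihilating_functional:
  fixes n :: nat
  assumes "\<exists>i<n. g i \<notin> K"
  shows "\<exists>v. (\<exists>i<n. v i \<noteq> 0) \<and>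
    (\<forall>c. (\<forall>i<n. c i \<in> K) \<longrightarrow> (\<Sum>i<n. c i * g i) \<in> K \<longrightarrow> (\<Sum>i<n. c i * v i) = 0)"
  using assms
proof (induction n)
  case (Suc n)
  show ?case
  \<comment> \<open>Either some relation modulo \<open>K\<close> involves \<open>g n\<close>, which
    forces the value of the functional there, or every relation has \<open>c n = 0\<close>, and the
    indicator of \<open>n\<close> works.\<close>
  proof (cases "\<exists>c. (\<forall>i<Suc n. c i \<in> K) \<and> (\<Sum>i<Suc n. c i * g i) \<in> K \<and> c n \<noteq> 0")
    case True
    then obtain c where c: "\<And>i. i < Suc n \<Longrightarrow> c i \<in> K" "(\<Sum>i<Suc n. c i * g i) \<in> K" "c n \<noteq> 0"
      by blast
    define e where "e i = - (c i / c n)" for i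
    define \<kappa> where "\<kappa> = (\<Sum>i<Suc n. c i * g i) / c n"
    have e: "e i \<in> K" if "i < n" for i
      unfolding e_def using that by (intro complex_subfield_uminus complex_subfield_divide c) auto
    have \<kappa>: "\<kappa> \<in> K" unfolding \<kappa>_def by (intro complex_subfield_divide c) simp
    have gn: "g n = (\<Sum>i<n. e i * g i) + \<kappa>"
      using c(3) by (simp add: e_def \<kappa>_def sum_negf sum_divide_distrib[symmetric] add_divide_distrib)
    have "\<exists>i<n. g i \<notin> K"
    proof (rule ccontr)
      assume neg: "\<not> (\<exists>i<n. g i \<notin> K)"
      then have "g n \<in> K" unfolding gn
        by (intro complex_subfield_add complex_subfield_sum complex_subfield_mult e \<kappa>) auto
      with neg Suc.prems show False by (auto simp: less_Suc_eq)
    qed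
    then obtain v j where v: "j < n" "v j \<noteq> 0"
      "\<And>c. (\<forall>i<n. c i \<in> K) \<Longrightarrow> (\<Sum>i<n. c i * g i) \<in> K \<Longrightarrow> (\<Sum>i<n. c i * v i) = 0"
      using Suc.IH by blast
    define v' where "v' = v(n := \<Sum>i<n. e i * v i)"
    \<comment> \<open>Eliminating the last vector leaves a combination of length \<open>n\<close>
      plus a defect term. The defect is \<open>d n * \<kappa>\<close> for \<open>g\<close> and zero
      for \<open>v'\<close>.\<close>
    have split: "(\<Sum>i<Suc n. d i * f i) = (\<Sum>i<n. (d i + d n * e i) * f i) + d n * (f n - (\<Sum>i<n. e i * f i))"
      for d f :: "nat \<Rightarrow> complex"
      by (simp add: algebra_simps sum.distrib sum_distrib_left)
    have "(\<Sum>i<Suc n. d i * v' i) = 0"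
      if d: "\<forall>i<Suc n. d i \<in> K" and rel: "(\<Sum>i<Suc n. d i * g i) \<in> K" for d
    proof -
      have "(\<Sum>i<n. (d i + d n * e i) * g i) = (\<Sum>i<Suc n. d i * g i) - d n * \<kappa>"
        using split[of d g] gn by simp
      also have "\<dots> \<in> K" using d rel \<kappa> by (intro complex_subfield_diff complex_subfield_mult) auto
      finally have "(\<Sum>i<n. (d i + d n * e i) * v i) = 0"
        using d e by (intro v(3)) (auto intro!: complex_subfield_add complex_subfield_mult)
      moreover have "(\<Sum>i<n. (d i + d n * e i) * v' i) = (\<Sum>i<n. (d i + d n * e i) * v i)"
        by (intro sum.cong) (auto simp: v'_def)
      moreover have "v' n - (\<Sum>i<n. e i * v' i) = 0"
        by (simp add: v'_def)
      ultimately show ?thesis by (simp only: split) simp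
    qed
    moreover have "\<exists>i<Suc n. v' i \<noteq> 0" using v(1,2) by (intro exI[of _ j]) (auto simp: v'_def)
    ultimately show ?thesis by blast
  next
    case False
    then show ?thesis
      by (intro exI[of _ "\<lambda>i. of_bool (i = n)"]) (auto simp: of_bool_def if_distrib[of "\<lambda>x. _ * x"] cong: if_cong)
  qed
qed simp

context
  fixes \<psi> :: "complex \<Rightarrow> complex"
  assumes \<psi>: "field_embedding K \<psi>"
begin

lemma field_embedding_1: "\<psi> 1 = 1"
  and field_embedding_add: "a \<in> K \<Longrightarrow> b \<in> K \<Longrightarrow> \<psi> (a + b) = \<psi> a + \<psi> b"
  and field_embedding_mult: "a \<in> K \<Longrightarrow> b \<in> K \<Longrightarrow> \<psi> (a * b) = \<psi> a * \<psi> b"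
  using \<psi> by (auto simp: field_embedding_def)

lemma field_embedding_0: "\<psi> 0 = 0"
  using field_embedding_add[OF complex_subfield_0 complex_subfield_0] by simp

lemma field_embedding_uminus: "a \<in> K \<Longrightarrow> \<psi> (- a) = - \<psi> a"
  using field_embedding_add[of a "- a"] complex_subfield_uminus[of a] field_embedding_0
  by (simp add: eq_neg_iff_add_eq_0 add.commute)

lemma field_embedding_diff: "a \<in> K \<Longrightarrow> b \<in> K \<Longrightarrow> \<psi> (a - b) = \<psi> a - \<psi> b"
  using field_embedding_add[of a "- b"] complex_subfield_uminus[of b] field_embedding_uminus[of b]
  by simp

lemma field_embedding_inverse: "a \<in> K \<Longrightarrow> \<psi> (inverse a) = inverse (\<psi> a)"
proof (cases "a = 0")
  case False
  assume a: "a \<in> K"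
  have "\<psi> a * \<psi> (inverse a) = 1"
    using field_embedding_mult[OF a complex_subfield_inverse[OF a]] False field_embedding_1 by simp
  then show ?thesis by (metis inverse_unique)
qed (simp add: field_embedding_0)

lemma field_embedding_divide: "a \<in> K \<Longrightarrow> b \<in> K \<Longrightarrow> \<psi> (a / b) = \<psi> a / \<psi> b"
  by (simp add: divide_inverse field_embedding_mult complex_subfield_inverse field_embedding_inverse)

lemma field_embedding_power: "a \<in> K \<Longrightarrow> \<psi> (a ^ n) = \<psi> a ^ n"
  by (induction n) (simp_all add: field_embedding_1 field_embedding_mult complex_subfield_power)

lemma field_embedding_sum: "(\<And>i. i \<in> I \<Longrightarrow> f i \<in> K) \<Longrightarrow> \<psi> (sum f I) = (\<Sum>i\<in>I. \<psi> (f i))"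
  by (induction I rule: infinite_finite_induct)
    (simp_all add: field_embedding_0 field_embedding_add complex_subfield_sum)

lemma field_embedding_prod: "(\<And>i. i \<in> I \<Longrightarrow> f i \<in> K) \<Longrightarrow> \<psi> (prod f I) = (\<Prod>i\<in>I. \<psi> (f i))"
  by (induction I rule: infinite_finite_induct)
    (simp_all add: field_embedding_1 field_embedding_mult complex_subfield_prod)

lemma field_embedding_of_nat: "\<psi> (of_nat n) = of_nat n"
  by (induction n)
    (simp_all add: field_embedding_0 field_embedding_1 field_embedding_add complex_subfield_1 complex_subfield_of_nat)

lemma field_embedding_of_int: "\<psi> (of_int n) = of_int n"
  by (cases n rule: int_cases2)
    (simp_all add: field_embedding_of_nat field_embedding_uminus complex_subfield_of_nat)

lemma field_embedding_Rats:
  assumes "a \<in> \<rat>"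
  shows "\<psi> a = a"
proof -
  obtain m n where "a = of_int m / of_int n" using assms by (auto elim: Rats_cases')
  then show ?thesis by (simp add: field_embedding_divide complex_subfield_of_int field_embedding_of_int)
qed

end

end

section \<open>The field generated by one number\<close>

lemma complex_subfield_rat_adjoin: "complex_subfield (rat_adjoin z)"
  unfolding complex_subfield_def rat_adjoin_def gen_subfield_def by blast

lemma generator_in_rat_adjoin: "z \<in> rat_adjoin z"
  by (simp add: rat_adjoin_def gen_subfield_def)

lemma rat_adjoin_minimal: "complex_subfield K \<Longrightarrow> z \<in> K \<Longrightarrow> rat_adjoin z \<subseteq> K"
  unfolding complex_subfield_def rat_adjoin_def gen_subfield_def by blast

text \<open>The elements fixed by \<psi> form a subfield containing \<open>z\<close>, hence exhaust
  the least one.\<close>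

lemma field_embedding_rat_adjoin_eq_id:
  assumes \<psi>: "field_embedding (rat_adjoin z) \<psi>" and z: "\<psi> z = z" and a: "a \<in> rat_adjoin z"
  shows "\<psi> a = a"
proof -
  note K = complex_subfield_rat_adjoin[of z]
  let ?L = "{a \<in> rat_adjoin z. \<psi> a = a}"
  have "complex_subfield ?L"
    unfolding complex_subfield_def
    by (auto intro: complex_subfield_1[OF K] complex_subfield_add[OF K] complex_subfield_mult[OF K]
        complex_subfield_uminus[OF K] complex_subfield_inverse[OF K]
        simp: field_embedding_1[OF K \<psi>] field_embedding_add[OF K \<psi>] field_embedding_mult[OF K \<psi>]
        field_embedding_uminus[OF K \<psi>] field_embedding_inverse[OF K \<psi>])
  then have "rat_adjoin z \<subseteq> ?L" using rat_adjoin_minimal generator_in_rat_adjoin z by auto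
  with a show ?thesis by blast
qed

section \<open>Weights determined by the expansions of rational numbers\<close>

text \<open>Splitting off the first \<open>p\<close> terms bounds each partial sum by the first
  block plus \<rho> times the same partial sum.\<close>

lemma summable_quasi_periodic:
  fixes h :: "nat \<Rightarrow> real"
  assumes "\<And>t. h t \<ge> 0" and step: "\<And>t. h (t + p) = \<rho> * h t" and "\<rho> < 1"
  shows "summable h"
proof (rule summableI_nonneg_bounded)
  fix n
  have "sum h {..<n + p} = sum h {..<p} + \<rho> * sum h {..<n}"
    by (induction n) (simp_all add: step distrib_left)
  moreover have "sum h {..<n} \<le> sum h {..<n + p}" using assms(1) by (intro sum_mono2) auto
  ultimately show "sum h {..<n} \<le> sum h {..<p} / (1 - \<rho>)"
    using assms(3) by (simp add: field_simps)
qed (use assms in auto)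

lemma sum_lessThan_mult_group:
  fixes f :: "nat \<Rightarrow> 'a :: comm_monoid_add"
  shows "sum f {..<m * p} = (\<Sum>i<p. \<Sum>j<m. f (j * p + i))"
proof -
  have "sum f {..<m * p} = (\<Sum>j<m. \<Sum>i<p. f (j * p + i))"
  proof (induction m)
    case (Suc m)
    have "sum f {..<n + k} = sum f {..<n} + (\<Sum>i<k. f (n + i))" for n k
      by (induction k) (simp_all add: add.assoc)
    from this[of "m * p" p] show ?case using Suc by (simp add: add.commute)
  qed simp
  also have "\<dots> = (\<Sum>i<p. \<Sum>j<m. f (j * p + i))" by (rule sum.swap)
  finally show ?thesis .
qed

text \<open>The bound \<open>\<gamma> \<le> 1\<close> places the rationals in question in the unit
  interval, where the digit bounds hold.\<close>

locale periodic_base = alternate_base +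
  fixes \<gamma> :: real
  assumes gamma: "0 < \<gamma>" "\<gamma> \<le> 1"
    and periodic: "x \<in> {0<..<\<gamma>} \<inter> \<rat> \<Longrightarrow> purely_periodic_expansion p beta x"
begin

lemma small_in_unit_interval: "x \<in> {0<..<\<gamma>} \<inter> \<rat> \<Longrightarrow> x \<in> {0..<1}"
  using gamma by auto

text \<open>Multiples of periods are periods, so a product serves all of \<open>S\<close>. The
  factor \<open>p\<close> aligns the digit period with that of the base.\<close>

lemma common_period:
  assumes "finite S" and "S \<subseteq> {0<..<\<gamma>} \<inter> \<rat>"
  shows "\<exists>m>0. \<forall>x\<in>S. has_period x (m * p)"
  using assms
proof (induction rule: finite_induct)
  case (insert x S)
  then obtain m where m: "m > 0" "\<And>y. y \<in> S \<Longrightarrow> has_period y (m * p)" by auto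
  obtain n where n: "n > 0" "has_period x n"
    using purely_periodic_imp_has_period periodic insert.prems by blast
  have "has_period x (n * m * p)"
    using has_period_mult[OF n(2), of "m * p"] by (simp add: mult_ac)
  moreover have "has_period y (n * m * p)" if "y \<in> S" for y
    using has_period_mult[OF m(2)[OF that], of n] by (simp add: mult_ac)
  ultimately show ?case using m(1) n(1) by (intro exI[of _ "n * m"]) auto
qed auto

text \<open>In the limit the relation becomes an infinite series with value
  \<open>x * \<Lambda>\<close>. For rational \<open>x\<close> just above
  \<open>1 / P (Suc k)\<close> this series is \<open>v k\<close> plus a tail that is small uniformly
  in \<open>x\<close>; letting \<open>x\<close> approach \<open>1 / P (Suc k)\<close> gives the
  claim.\<close>

lemma weights_unique:
  fixes v :: "nat \<Rightarrow> complex"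
  assumes step: "\<And>t. v (t + p) = y * v t" and y: "norm y < 1"
    and rel: "\<And>x m. x \<in> {0<..<\<gamma>} \<inter> \<rat> \<Longrightarrow> has_period x (m * p) \<Longrightarrow>
      (\<Sum>t<m * p. of_int (dig x t) * v t) = of_real x * \<Lambda> * (1 - y ^ m)"
    and k: "1 / P (Suc k) < \<gamma>"
  shows "v k = \<Lambda> / of_real (P (Suc k))"
proof -
  obtain B where B: "B > 0" "\<And>k. b k \<le> B" using b_bounded by blast
  have sv: "summable (\<lambda>t. norm (v t))"
    by (rule summable_quasi_periodic[where p = p and \<rho> = "norm y"]) (use step y in \<open>auto simp: norm_mult\<close>)
  have nd: "norm (of_int (dig x t) * v t) \<le> B * norm (v t)" if "x \<in> {0<..<\<gamma>} \<inter> \<rat>" for x t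
  proof -
    have "x \<in> {0..<1}" using that gamma by auto
    from dig_nonneg[OF this, of t] dig_le[OF this, of t] B(2)[of t]
    have "\<bar>real_of_int (dig x t)\<bar> \<le> B" by linarith
    then show ?thesis by (simp add: norm_mult mult_right_mono)
  qed
  have sd: "summable (\<lambda>t. norm (of_int (dig x t) * v t))" if "x \<in> {0<..<\<gamma>} \<inter> \<rat>" for x
    by (rule summable_comparison_test'[OF summable_mult[OF sv, of B]]) (use nd[OF that] in simp)
  \<comment> \<open>Along the multiples \<open>s * m\<close> of one period the finite relations
    converge to the full series, because \<open>(y ^ m) ^ s\<close> tends to 0.\<close>
  have sums: "(\<Sum>t. of_int (dig x t) * v t) = of_real x * \<Lambda>" if x: "x \<in> {0<..<\<gamma>} \<inter> \<rat>" for x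
  proof -
    obtain m where m: "m > 0" "has_period x (m * p)" using common_period[of "{x}"] x by auto
    have "(\<lambda>n. \<Sum>t<n. of_int (dig x t) * v t) \<longlonglongrightarrow> (\<Sum>t. of_int (dig x t) * v t)"
      using summable_LIMSEQ[OF summable_norm_cancel[OF sd[OF x]]] .
    moreover have "strict_mono (\<lambda>s. s * (m * p))"
      using m(1) p_pos by (auto intro!: strict_monoI)
    ultimately have "(\<lambda>s. \<Sum>t<s * (m * p). of_int (dig x t) * v t) \<longlonglongrightarrow> (\<Sum>t. of_int (dig x t) * v t)"
      using LIMSEQ_subseq_LIMSEQ[unfolded comp_def] by blast
    moreover have "(\<Sum>t<s * (m * p). of_int (dig x t) * v t) = of_real x * \<Lambda> * (1 - (y ^ m) ^ s)" for s
    proof -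
      have "y ^ (s * m) = (y ^ m) ^ s" by (metis power_mult mult.commute)
      then show ?thesis
        using rel[OF x, of "s * m"] has_period_mult[OF m(2), of s] by (simp only: mult.assoc)
    qed
    moreover have "(\<lambda>s. of_real x * \<Lambda> * (1 - (y ^ m) ^ s)) \<longlonglongrightarrow> of_real x * \<Lambda> * (1 - 0)"
    proof -
      have "norm (y ^ m) < 1" using y m(1) by (simp add: norm_power power_less_one_iff)
      then show ?thesis by (intro tendsto_intros LIMSEQ_power_zero)
    qed
    ultimately show ?thesis using LIMSEQ_unique by fastforce
  qed
  have "norm (v k - \<Lambda> / of_real (P (Suc k))) \<le> \<epsilon>" if "\<epsilon> > 0" for \<epsilon>
  proof -
    have "\<epsilon> / 2 / B > 0" using that B(1) by simp
    \<comment> \<open>The digits are at most \<open>B\<close>, so this \<open>N\<close> controls the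
      tail for all \<open>x\<close> at once.\<close>
    from suminf_exist_split[OF this sv] obtain N
      where N: "\<And>n. n \<ge> N \<Longrightarrow> norm (\<Sum>i. norm (v (i + n))) < \<epsilon> / 2 / B" by blast
    define M where "M = max N (Suc k)"
    obtain \<eta> where \<eta>: "\<eta> > 0"
      "\<And>x t. 1 / P (Suc k) \<le> x \<Longrightarrow> x < 1 / P (Suc k) + \<eta> \<Longrightarrow> t < M \<Longrightarrow> dig x t = of_bool (t = k)"
      using single_digit_right_of_inverse_P[of k M] by blast
    \<comment> \<open>The three bounds secure the digits before \<open>M\<close>, the condition
      \<open>x < \<gamma>\<close>, and an error of at most \<open>\<epsilon> / 2\<close> in
      \<open>x * \<Lambda>\<close>. Adding 1 avoids a zero denominator.\<close>
    define \<epsilon>' where "\<epsilon>' = min \<eta> (min (\<gamma> - 1 / P (Suc k)) (\<epsilon> / 2 / (norm \<Lambda> + 1)))"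
    have "norm \<Lambda> + 1 > 0" using norm_ge_zero[of \<Lambda>] by linarith
    then have "\<epsilon>' > 0" using \<eta>(1) k that by (simp add: \<epsilon>'_def del: P_Suc)
    then obtain q where q: "1 / P (Suc k) < of_rat q" "of_rat q < 1 / P (Suc k) + \<epsilon>'"
      using of_rat_dense[of "1 / P (Suc k)" "1 / P (Suc k) + \<epsilon>'"] by auto
    define x :: real where "x = of_rat q"
    have "1 / P (Suc k) > 0" by (simp del: P_Suc)
    then have "0 < x" "x < \<gamma>" using q unfolding x_def \<epsilon>'_def by linarith+
    then have x: "x \<in> {0<..<\<gamma>} \<inter> \<rat>" by (simp add: x_def)
    have "of_real x * \<Lambda> = (\<Sum>t. of_int (dig x t) * v t)" using sums[OF x] by simp
    also have "\<dots> = (\<Sum>i. of_int (dig x (i + M)) * v (i + M)) + (\<Sum>t<M. of_int (dig x t) * v t)"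
      by (rule suminf_split_initial_segment[OF summable_norm_cancel[OF sd[OF x]]])
    also have "(\<Sum>t<M. of_int (dig x t) * v t) = (\<Sum>t<M. if t = k then v t else 0)"
      using q by (intro sum.cong) (auto simp: \<eta>(2) x_def \<epsilon>'_def simp del: P_Suc)
    also have "\<dots> = v k" by (simp add: M_def)
    finally have eq: "v k - of_real x * \<Lambda> = - (\<Sum>i. of_int (dig x (i + M)) * v (i + M))" by simp
    have sM: "summable (\<lambda>i. norm (v (i + M)))" "summable (\<lambda>i. norm (of_int (dig x (i + M)) * v (i + M)))"
      using summable_ignore_initial_segment[OF sv] summable_ignore_initial_segment[OF sd[OF x]] by auto
    have "norm (v k - of_real x * \<Lambda>) \<le> (\<Sum>i. norm (of_int (dig x (i + M)) * v (i + M)))"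
      unfolding eq norm_minus_cancel by (rule summable_norm[OF sM(2)])
    also have "\<dots> \<le> (\<Sum>i. B * norm (v (i + M)))"
      by (intro suminf_le nd[OF x] sM(2) summable_mult sM(1))
    also have "\<dots> = B * (\<Sum>i. norm (v (i + M)))" by (rule suminf_mult[OF sM(1)])
    also have "\<dots> \<le> B * (\<epsilon> / 2 / B)"
      using N[of M] B(1) by (intro mult_left_mono) (auto simp: M_def)
    also have "\<dots> = \<epsilon> / 2" using B(1) by simp
    finally have 1: "norm (v k - of_real x * \<Lambda>) \<le> \<epsilon> / 2" .
    have "norm (of_real x * \<Lambda> - \<Lambda> / of_real (P (Suc k))) = \<bar>x - 1 / P (Suc k)\<bar> * norm \<Lambda>"
    proof -
      have "of_real x * \<Lambda> - \<Lambda> / of_real (P (Suc k)) = of_real (x - 1 / P (Suc k)) * \<Lambda>"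
        by (simp add: algebra_simps del: P_Suc)
      then show ?thesis by (simp only: norm_mult norm_of_real)
    qed
    also have "\<dots> \<le> (\<epsilon> / 2 / (norm \<Lambda> + 1)) * (norm \<Lambda> + 1)"
      using q that by (intro mult_mono) (auto simp: x_def \<epsilon>'_def simp del: P_Suc)
    also have "\<dots> = \<epsilon> / 2" using \<open>norm \<Lambda> + 1 > 0\<close> by (simp add: field_simps)
    finally show ?thesis using 1 norm_triangle_ineq[of "v k - of_real x * \<Lambda>" "of_real x * \<Lambda> - \<Lambda> / of_real (P (Suc k))"]
      by simp
  qed
  then have "norm (v k - \<Lambda> / of_real (P (Suc k))) \<le> 0" by (rule field_le_epsilon) simp
  then show ?thesis by simp
qed

section \<open>Weights and bases as elements of the field generated by \<delta>\<close>

lemma weight_step: "P (Suc (t + p)) = \<delta> * P (Suc t)"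
  using P_add_p[of "Suc t"] by simp

lemma small_weights: "\<exists>T. \<forall>k\<ge>T. 1 / P (Suc k) < \<gamma>"
proof -
  obtain N where N: "\<And>k. k \<ge> N \<Longrightarrow> 1 / \<gamma> < P k" using P_tail_unbounded by blast
  have "1 / P (Suc k) < \<gamma>" if "k \<ge> N" for k
    using N[of "Suc k"] that gamma by (simp add: field_simps del: P_Suc)
  then show ?thesis by blast
qed

lemma periodic_expansion_complex:
  assumes "x \<in> {0<..<\<gamma>} \<inter> \<rat>" and "has_period x (m * p)"
  shows "of_real x * (1 - (1 / of_real \<delta>) ^ m) =
    (\<Sum>t<m * p. of_int (dig x t) * (1 / complex_of_real (P (Suc t))))"
proof -
  have "x \<in> {0..<1}" using assms gamma by auto
  from arg_cong[OF periodic_expansion[OF this assms(2)], of complex_of_real]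
  show ?thesis by (simp add: power_divide del: P_Suc)
qed

text \<open>Every weight is one of the \<open>p\<close> numbers \<open>g i\<close> times a power of
  \<open>1 / \<delta>\<close>. Were some \<open>g i\<close> outside \<open>K\<close>, a nonzero
  functional killing \<open>K\<close> would give weights satisfying all relations with value 0,
  which \<open>weights_unique\<close> forces to vanish at large indices.\<close>

lemma inverse_P_in_field:
  assumes K: "complex_subfield K" and \<delta>: "of_real \<delta> \<in> K"
  shows "1 / of_real (P t) \<in> K"
proof -
  define g where "g i = 1 / complex_of_real (P (Suc i))" for i
  have g_eq: "1 / complex_of_real (P (Suc (j * p + i))) = (1 / of_real \<delta>) ^ j * g i" for i j
    using P_add_mult_p[of "Suc i" j] by (simp add: g_def power_divide add.commute del: P_Suc)
  have y: "(1 / of_real \<delta>) ^ j \<in> K" for j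
    by (intro complex_subfield_power[OF K] complex_subfield_divide[OF K] complex_subfield_1[OF K] \<delta>)
  have "g i \<in> K" if "i < p" for i
  proof (rule ccontr)
    assume "g i \<notin> K"
    with that obtain v l where v: "l < p" "v l \<noteq> 0"
      "\<And>c. (\<forall>i<p. c i \<in> K) \<Longrightarrow> (\<Sum>i<p. c i * g i) \<in> K \<Longrightarrow> (\<Sum>i<p. c i * v i) = 0"
      using annihilating_functional[OF K, of p g] by blast
    \<comment> \<open>The functional applied to the weights \<open>1 / P (Suc t)\<close>, extended
      by linearity over \<open>K\<close>.\<close>
    define V where "V t = (1 / complex_of_real \<delta>) ^ (t div p) * v (t mod p)" for t
    obtain T where T: "\<And>k. k \<ge> T \<Longrightarrow> 1 / P (Suc k) < \<gamma>" using small_weights by blast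
    \<comment> \<open>The index is at least \<open>T\<close> and congruent to \<open>l\<close>, so
      \<open>V\<close> is there a nonzero multiple of \<open>v l\<close>.\<close>
    have "V (T * p + l) = 0 / of_real (P (Suc (T * p + l)))"
    proof (rule weights_unique)
      show "V (t + p) = (1 / of_real \<delta>) * V t" for t using p_pos by (simp add: V_def)
      show "norm (1 / complex_of_real \<delta>) < 1" using delta_gt_1 by (simp add: norm_divide)
      have "T \<le> T * p" using p_pos by simp
      then show "1 / P (Suc (T * p + l)) < \<gamma>" by (intro T) linarith
      fix x m assume x: "x \<in> {0<..<\<gamma>} \<inter> \<rat>" and per: "has_period x (m * p)"
      define c where "c i = (\<Sum>j<m. of_int (dig x (j * p + i)) * (1 / complex_of_real \<delta>) ^ j)" for i
      have "(\<Sum>i<p. c i * v i) = 0"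
      proof (rule v(3))
        show "\<forall>i<p. c i \<in> K" unfolding c_def
          by (intro allI impI complex_subfield_sum[OF K] complex_subfield_mult[OF K] y
              complex_subfield_of_int[OF K])
        have "(\<Sum>i<p. c i * g i) = (\<Sum>t<m * p. of_int (dig x t) * (1 / complex_of_real (P (Suc t))))"
          unfolding sum_lessThan_mult_group g_eq c_def by (simp add: sum_distrib_right mult.assoc)
        also have "\<dots> = of_real x * (1 - (1 / of_real \<delta>) ^ m)"
          using periodic_expansion_complex[OF x per] by simp
        also have "\<dots> \<in> K"
        proof -
          have "complex_of_real x \<in> \<rat>" using x by (auto elim!: Rats_cases)
          then show ?thesis
            by (intro complex_subfield_mult[OF K] complex_subfield_diff[OF K] y
              complex_subfield_1[OF K] complex_subfield_Rats[OF K])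
        qed
        finally show "(\<Sum>i<p. c i * g i) \<in> K" .
      qed
      moreover have "(\<Sum>t<m * p. of_int (dig x t) * V t) = (\<Sum>i<p. c i * v i)"
        unfolding sum_lessThan_mult_group c_def sum_distrib_right
        by (intro sum.cong refl) (auto simp: V_def)
      ultimately show "(\<Sum>t<m * p. of_int (dig x t) * V t) = of_real x * 0 * (1 - (1 / of_real \<delta>) ^ m)"
        by simp
    qed
    then show False using v(1,2) delta_gt_1 by (simp add: V_def)
  qed
  then have all: "1 / complex_of_real (P (Suc t)) \<in> K" for t
    using g_eq[of "t div p" "t mod p"] y p_pos by (simp add: complex_subfield_mult[OF K])
  show ?thesis
  proof (cases t)
    case 0
    then show ?thesis using complex_subfield_1[OF K] by simp
  qed (use all in simp)
qed

text \<open>Each base is a quotient of two consecutive weights.\<close>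

lemma beta_in_rat_adjoin:
  assumes "i \<in> {1..p}"
  shows "complex_of_real (beta i) \<in> rat_adjoin (of_real \<delta>)"
proof -
  note K = complex_subfield_rat_adjoin[of "of_real \<delta>"]
  note inv = inverse_P_in_field[OF K generator_in_rat_adjoin]
  have "(i - 1) mod p = i - 1" using assms by (intro mod_less) auto
  then have "beta i = b (i - 1)" using assms by (simp add: b_eq)
  then have "complex_of_real (beta i) = (1 / of_real (P (i - 1))) / (1 / of_real (P (Suc (i - 1))))"
    by simp
  also have "\<dots> \<in> rat_adjoin (of_real \<delta>)" by (intro complex_subfield_divide[OF K] inv)
  finally show ?thesis .
qed

section \<open>Images of expansions under embeddings\<close>

lemma embedding_periodic_expansion:
  assumes \<psi>: "field_embedding (rat_adjoin (of_real \<delta>)) \<psi>"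
    and x: "x \<in> {0<..<\<gamma>} \<inter> \<rat>" and per: "has_period x (m * p)"
  shows "of_real x * (1 - (1 / \<psi> (of_real \<delta>)) ^ m) =
    (\<Sum>t<m * p. of_int (dig x t) * \<psi> (1 / of_real (P (Suc t))))"
proof -
  note K = complex_subfield_rat_adjoin[of "of_real \<delta>"]
  note \<delta> = generator_in_rat_adjoin[of "complex_of_real \<delta>"]
  note inv = inverse_P_in_field[OF K \<delta>]
  note one = complex_subfield_1[OF K]
  note y = complex_subfield_divide[OF K one \<delta>]
  note ym = complex_subfield_power[OF K y, of m]
  have xq: "complex_of_real x \<in> \<rat>" using x by (auto elim!: Rats_cases)
  have "of_real x * (1 - (1 / \<psi> (of_real \<delta>)) ^ m) = \<psi> (of_real x * (1 - (1 / of_real \<delta>) ^ m))"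
    by (simp only: field_embedding_mult[OF K \<psi> complex_subfield_Rats[OF K xq] complex_subfield_diff[OF K one ym]]
        field_embedding_diff[OF K \<psi> one ym] field_embedding_power[OF K \<psi> y]
        field_embedding_divide[OF K \<psi> one \<delta>] field_embedding_1[OF K \<psi>] field_embedding_Rats[OF K \<psi> xq])
  also have "\<dots> = \<psi> (\<Sum>t<m * p. of_int (dig x t) * (1 / complex_of_real (P (Suc t))))"
    using periodic_expansion_complex[OF x per] by simp
  also have "\<dots> = (\<Sum>t<m * p. \<psi> (of_int (dig x t) * (1 / complex_of_real (P (Suc t)))))"
    by (intro field_embedding_sum[OF K \<psi>] complex_subfield_mult[OF K] complex_subfield_of_int[OF K] inv)
  also have "\<dots> = (\<Sum>t<m * p. of_int (dig x t) * \<psi> (1 / of_real (P (Suc t))))"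
    by (intro sum.cong refl)
      (simp only: field_embedding_mult[OF K \<psi> complex_subfield_of_int[OF K] inv] field_embedding_of_int[OF K \<psi>])
  finally show ?thesis .
qed

text \<open>The images of the weights have ratio \<open>1 / \<psi> \<delta>\<close> of modulus below
  1 and satisfy the relations with value 1, so they agree with the weights at large indices.
  Comparing indices \<open>T\<close> and \<open>T + p\<close> gives the claim.\<close>

lemma expanding_embedding_fixes_delta:
  assumes \<psi>: "field_embedding (rat_adjoin (of_real \<delta>)) \<psi>" and gt: "norm (\<psi> (of_real \<delta>)) > 1"
  shows "\<psi> (of_real \<delta>) = of_real \<delta>"
proof -
  note K = complex_subfield_rat_adjoin[of "of_real \<delta>"]
  note \<delta> = generator_in_rat_adjoin[of "complex_of_real \<delta>"]
  note inv = inverse_P_in_field[OF K \<delta>]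
  define v where "v t = \<psi> (1 / of_real (P (Suc t)))" for t
  have step: "v (t + p) = (1 / \<psi> (of_real \<delta>)) * v t" for t
  proof -
    have "1 / complex_of_real (P (Suc (t + p))) = (1 / of_real \<delta>) * (1 / of_real (P (Suc t)))"
      by (simp add: weight_step del: P_Suc)
    then show ?thesis
      by (simp only: v_def field_embedding_mult[OF K \<psi> inv inv]
          field_embedding_divide[OF K \<psi> complex_subfield_1[OF K] \<delta>] field_embedding_1[OF K \<psi>])
  qed
  have v: "v k = 1 / of_real (P (Suc k))" if "1 / P (Suc k) < \<gamma>" for k
  proof (rule weights_unique[where v = v, OF _ _ _ that])
    show "v (t + p) = (1 / \<psi> (of_real \<delta>)) * v t" for t by (rule step)
    show "norm (1 / \<psi> (of_real \<delta>)) < 1" using gt by (simp add: norm_divide divide_less_eq)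
  qed (use embedding_periodic_expansion[OF \<psi>] in \<open>simp add: v_def\<close>)
  obtain T where T: "\<And>k. k \<ge> T \<Longrightarrow> 1 / P (Suc k) < \<gamma>" using small_weights by blast
  have "(1 / \<psi> (of_real \<delta>)) * (1 / of_real (P (Suc T))) = 1 / of_real (P (Suc (T + p)))"
    using step[of T] unfolding v[OF T[OF order_refl]] v[OF T[OF le_add1]] by (rule sym)
  then have "1 / \<psi> (of_real \<delta>) = 1 / complex_of_real \<delta>"
    by (simp add: weight_step field_simps del: P_Suc)
  then show ?thesis by (metis inverse_eq_divide inverse_inverse_eq)
qed

lemma exists_periodic_rational:
  obtains x m where "x \<in> {0<..<\<gamma>} \<inter> \<rat>" "m > 0" "has_period x (m * p)"
proof -
  obtain q where "0 < real_of_rat q" "of_rat q < \<gamma>" using of_rat_dense[OF gamma(1)] by blast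
  then have "real_of_rat q \<in> {0<..<\<gamma>} \<inter> \<rat>" by simp
  moreover from this obtain m where "m > 0" "has_period (of_rat q) (m * p)"
    using common_period[of "{of_rat q}"] by auto
  ultimately show ?thesis using that by blast
qed

lemma embedding_not_positive:
  assumes \<psi>: "field_embedding (rat_adjoin (of_real \<delta>)) \<psi>"
    and nonid: "\<exists>a\<in>rat_adjoin (of_real \<delta>). \<psi> a \<noteq> a"
  shows "\<not> (\<forall>i\<in>{1..p}. \<psi> (of_real (beta i)) \<in> \<real> \<and> Re (\<psi> (of_real (beta i))) > 0)"
proof
  assume pos: "\<forall>i\<in>{1..p}. \<psi> (of_real (beta i)) \<in> \<real> \<and> Re (\<psi> (of_real (beta i))) > 0"
  note K = complex_subfield_rat_adjoin[of "of_real \<delta>"]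
  define c where "c k = Re (\<psi> (of_real (b k)))" for k
  have b_ix: "b k = beta (k mod p + 1)" "k mod p + 1 \<in> {1..p}" for k
    using p_pos by (auto simp: b_eq Suc_le_eq)
  have bK: "complex_of_real (b k) \<in> rat_adjoin (of_real \<delta>)" for k
    using beta_in_rat_adjoin b_ix by simp
  have c: "c k > 0" "\<psi> (of_real (b k)) = of_real (c k)" for k
    using pos b_ix[of k] by (auto simp: c_def)
  define C where "C n = (\<Prod>i<n. c i)" for n
  have C_pos: "C n > 0" for n unfolding C_def using c(1) by (intro prod_pos) auto
  have P_in: "complex_of_real (P n) \<in> rat_adjoin (of_real \<delta>)" for n
    unfolding P_def[of n] of_real_prod by (intro complex_subfield_prod[OF K] bK)
  have \<psi>_P: "\<psi> (of_real (P n)) = of_real (C n)" for n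
    unfolding P_def[of n] C_def of_real_prod by (subst field_embedding_prod[OF K \<psi>]) (simp_all add: bK c(2))
  have "\<psi> (of_real \<delta>) \<noteq> of_real \<delta>"
    using nonid field_embedding_rat_adjoin_eq_id[OF \<psi>] by blast
  \<comment> \<open>\<open>C p\<close> is the positive image of \<delta>; were it above 1, \<psi>
    would fix \<delta>.\<close>
  then have "C p \<le> 1"
    using expanding_embedding_fixes_delta[OF \<psi>] C_pos[of p] by (force simp: \<psi>_P)
  obtain x m where x: "x \<in> {0<..<\<gamma>} \<inter> \<rat>" "m > 0" "has_period x (m * p)"
    by (rule exists_periodic_rational)
  have x01: "x \<in> {0..<1}" using x gamma by auto
  have "complex_of_real (x * (1 - (1 / C p) ^ m)) = complex_of_real (\<Sum>t<m * p. of_int (dig x t) / C (Suc t))"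
    using embedding_periodic_expansion[OF \<psi> x(1,3)] \<psi>_P P_in
    by (simp add: field_embedding_divide[OF K \<psi>] complex_subfield_1[OF K] field_embedding_1[OF K \<psi>] del: P_Suc)
  then have eq: "x * (1 - (1 / C p) ^ m) = (\<Sum>t<m * p. of_int (dig x t) / C (Suc t))"
    by (simp only: of_real_eq_iff)
  have "1 \<le> 1 / C p" using \<open>C p \<le> 1\<close> C_pos[of p] by simp
  then have "1 \<le> (1 / C p) ^ m" by (rule one_le_power)
  then have "x * (1 - (1 / C p) ^ m) \<le> 0" using x by (intro mult_nonneg_nonpos) auto
  moreover have terms: "of_int (dig x t) / C (Suc t) \<ge> 0" for t
    using dig_nonneg[OF x01, of t] C_pos[of "Suc t"] by (intro divide_nonneg_pos) auto
  ultimately have "(\<Sum>t<m * p. of_int (dig x t) / C (Suc t)) = 0"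
    using eq sum_nonneg[of "{..<m * p}" "\<lambda>t. of_int (dig x t) / C (Suc t)"] by simp
  \<comment> \<open>A vanishing sum of nonnegative terms makes all digits zero, and the original
    expansion then yields \<open>x = 0\<close>.\<close>
  then have "\<forall>t\<in>{..<m * p}. of_int (dig x t) / C (Suc t) = 0"
    by (subst (asm) sum_nonneg_eq_0_iff) (use terms in auto)
  moreover have "C (Suc t) \<noteq> 0" for t using C_pos[of "Suc t"] by simp
  ultimately have "(\<Sum>t<m * p. of_int (dig x t) / P (Suc t)) = 0" by (intro sum.neutral) auto
  then have "x * (1 - 1 / \<delta> ^ m) = 0" using periodic_expansion[OF x01 x(3)] by simp
  moreover have "\<delta> ^ m > 1" using delta_gt_1 x(2) by (simp add: one_less_power)
  ultimately show False using x(1) by auto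
qed

end

section \<open>Algebraic integers\<close>

text \<open>The vector \<open>v\<close> is an eigenvector of an integer matrix, so \<open>z\<close>
  is a root of its monic integer characteristic polynomial.\<close>

lemma algebraic_integer_of_stable_module:
  fixes v :: "nat \<Rightarrow> complex" and C :: "nat \<Rightarrow> nat \<Rightarrow> int"
  assumes stable: "\<And>i. i < n \<Longrightarrow> z * v i = (\<Sum>j<n. of_int (C i j) * v j)"
    and "i < n" "v i \<noteq> 0"
  shows "algebraic_integer z"
proof -
  define A where "A = mat n n (\<lambda>(i, j). C i j)"
  have A: "A \<in> carrier_mat n n" by (simp add: A_def)
  define B :: "complex mat" where "B = map_mat of_int A"
  have B: "B \<in> carrier_mat n n" using A by (simp add: B_def)
  have "eigenvector B (Matrix.vec n v) z"
    unfolding eigenvector_def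
  proof (intro conjI)
    show "Matrix.vec n v \<in> carrier_vec (dim_row B)" using B by simp
    show "Matrix.vec n v \<noteq> 0\<^sub>v (dim_row B)"
    proof
      assume eq: "Matrix.vec n v = 0\<^sub>v (dim_row B)"
      have "v i = vec_index (Matrix.vec n v) i" using assms(2) by simp
      also have "\<dots> = 0" unfolding eq using B assms(2) by simp
      finally show False using assms(3) by simp
    qed
    show "B *\<^sub>v Matrix.vec n v = z \<cdot>\<^sub>v Matrix.vec n v"
    proof (rule eq_vecI)
      fix k assume "k < dim_vec (z \<cdot>\<^sub>v Matrix.vec n v)"
      then have k: "k < n" by simp
      have "vec_index (B *\<^sub>v Matrix.vec n v) k = (\<Sum>j<n. of_int (C k j) * v j)"
        using k by (simp add: B_def A_def scalar_prod_def atLeast0LessThan)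
      then show "vec_index (B *\<^sub>v Matrix.vec n v) k = vec_index (z \<cdot>\<^sub>v Matrix.vec n v) k"
        using k stable by simp
    qed (use B in simp)
  qed
  then have "eigenvalue B z" by (auto simp: eigenvalue_def)
  then have "poly (char_poly B) z = 0" using eigenvalue_root_char_poly[OF B] by simp
  moreover have "char_poly B = map_poly of_int (char_poly A)"
    unfolding B_def by (rule of_int_hom.char_poly_hom[OF A])
  ultimately show ?thesis
    unfolding algebraic_integer_def using degree_monic_char_poly[OF A]
    by (intro exI[of _ "char_poly A"]) simp
qed

section \<open>Integrality of \<delta>\<close>

context periodic_base
begin

text \<open>The module is spanned by the first \<open>n\<close> weights. From index \<open>p\<close>
  on, multiplication by \<delta> shifts the index down by \<open>p\<close>; for the first
  \<open>p\<close> weights it is expressed by the relation derived in \<open>low\<close>.\<close>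

lemma delta_algebraic_integer: "algebraic_integer (of_real \<delta>)"
proof -
  obtain N where N: "\<And>k. k \<ge> N \<Longrightarrow> 1 / P (Suc k) < \<gamma>" using small_weights by blast
  \<comment> \<open>The positions \<open>N * p + l\<close> with \<open>l < p\<close> fill the last
    block before \<open>M\<close>. Rescaling by \<open>\<delta> ^ Suc N\<close> therefore leaves one
    factor \<delta> on their weights and none on those from \<open>M\<close> on.\<close>
  define M where "M = Suc N * p"
  have NM: "N * p + l < M" if "l < p" for l using that by (simp add: M_def)
  have "N \<le> N * p" using p_pos by simp
  then have N': "1 / P (Suc (N * p + l)) < \<gamma>" for l by (intro N) linarith
  have "\<forall>l. \<exists>\<eta>>0. \<forall>x. 1 / P (Suc (N * p + l)) \<le> x \<longrightarrow> x < 1 / P (Suc (N * p + l)) + \<eta> \<longrightarrow>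
      (\<forall>t<M. dig x t = of_bool (t = N * p + l))"
    using single_digit_right_of_inverse_P by blast
  then obtain \<eta> where \<eta>: "\<And>l. \<eta> l > 0"
    "\<And>l x t. 1 / P (Suc (N * p + l)) \<le> x \<Longrightarrow> x < 1 / P (Suc (N * p + l)) + \<eta> l \<Longrightarrow> t < M \<Longrightarrow>
      dig x t = of_bool (t = N * p + l)"
    by metis
  have ev: "\<forall>\<^sub>F Q in sequentially. 1 / real Q < e" if "e > 0" for e
    using order_tendstoD(2)[OF lim_1_over_n that] by simp
  \<comment> \<open>For large \<open>Q\<close> the expansion of \<open>1 / Q\<close> begins with
    \<open>M\<close> zeros, and multiples of \<open>1 / Q\<close> come close enough to each
    \<open>1 / P (Suc (N * p + l))\<close> from above.\<close>
  have "\<forall>\<^sub>F Q in sequentially. Q > 0 \<and> 1 / real Q < \<gamma> \<and> 1 / real Q < 1 / P M \<and>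
      (\<forall>l\<in>{..<p}. 1 / real Q < min (\<eta> l) (\<gamma> - 1 / P (Suc (N * p + l))))"
    by (intro eventually_conj eventually_ball_finite ballI ev eventually_gt_at_top)
      (use gamma \<eta>(1) N' in \<open>auto simp del: P_Suc\<close>)
  then obtain Q :: nat where Q: "Q > 0" "1 / real Q < \<gamma>" "1 / real Q < 1 / P M"
    "\<And>l. l < p \<Longrightarrow> 1 / real Q < \<eta> l" "\<And>l. l < p \<Longrightarrow> 1 / real Q < \<gamma> - 1 / P (Suc (N * p + l))"
    by (auto dest!: eventually_happens'[OF sequentially_bot] simp del: P_Suc)
  \<comment> \<open>Rounding up puts \<open>x l\<close> at or above the target, by less than
    \<open>1 / Q\<close>.\<close>
  define c where "c l = \<lceil>real Q * (1 / P (Suc (N * p + l)))\<rceil>" for l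
  define x where "x l = of_int (c l) / real Q" for l
  have x_ge: "1 / P (Suc (N * p + l)) \<le> x l" for l
  proof -
    have "real Q * (1 / P (Suc (N * p + l))) \<le> of_int (c l)" unfolding c_def by (rule le_of_int_ceiling)
    then show ?thesis using Q(1) by (simp add: x_def field_simps del: P_Suc)
  qed
  have x_less: "x l < 1 / P (Suc (N * p + l)) + 1 / real Q" for l
  proof -
    have "of_int (c l) < real Q * (1 / P (Suc (N * p + l))) + 1"
      unfolding c_def using ceiling_correct[of "real Q * (1 / P (Suc (N * p + l)))"] by linarith
    then show ?thesis using Q(1) by (simp add: x_def field_simps del: P_Suc)
  qed
  have x_in: "x l \<in> {0<..<\<gamma>} \<inter> \<rat>" if "l < p" for l
  proof -
    have "0 < 1 / P (Suc (N * p + l))" by (simp del: P_Suc)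
    then have "0 < x l" "x l < \<gamma>" using x_ge[of l] x_less[of l] Q(5)[OF that] by linarith+
    then show ?thesis by (simp add: x_def)
  qed
  have q_in: "1 / real Q \<in> {0<..<\<gamma>} \<inter> \<rat>" using Q(1,2) by simp
  have fin: "finite (insert (1 / real Q) (x ` {..<p}))" by simp
  have sub: "insert (1 / real Q) (x ` {..<p}) \<subseteq> {0<..<\<gamma>} \<inter> \<rat>"
    using x_in q_in by blast
  obtain m0 where m0: "m0 > 0" "\<And>y. y \<in> insert (1 / real Q) (x ` {..<p}) \<Longrightarrow> has_period y (m0 * p)"
    using common_period[OF fin sub] by meson
  \<comment> \<open>A multiple of the common period exceeding \<open>Suc N\<close>, so that digits
    remain after position \<open>M\<close>.\<close>
  define m where "m = Suc (Suc N) * m0"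
  have per: "has_period y (m * p)" if "y \<in> insert (1 / real Q) (x ` {..<p})" for y
    using has_period_mult[OF m0(2)[OF that], of "Suc (Suc N)"] unfolding m_def by (simp only: mult.assoc)
  have "Suc N < m"
  proof -
    have "Suc (Suc N) * 1 \<le> m" unfolding m_def using m0(1) by (intro mult_le_mono2) simp
    then show ?thesis by simp
  qed
  then obtain k where k: "m = Suc (Suc N + k)" by (auto dest: less_imp_Suc_add)
  define n where "n = Suc k * p"
  have n: "m * p = M + n" "n > 0"
    using p_pos by (simp_all add: M_def n_def k algebra_simps)
  \<comment> \<open>Since \<open>x l = c l * (1 / Q)\<close>, the two periodic relations cancel to
    an integer relation among weights. Before \<open>M\<close> its only nonzero coefficient is a 1
    at \<open>N * p + l\<close>.\<close>
  define D where "D l t = dig (x l) t - c l * dig (1 / real Q) t" for l t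
  have D_initial: "D l t = of_bool (t = N * p + l)" if "l < p" "t < M" for l t
  proof -
    have "dig (x l) t = of_bool (t = N * p + l)"
      using x_ge[of l] x_less[of l] Q(4)[OF that(1)] that(2) by (intro \<eta>(2)) linarith+
    moreover have "dig (1 / real Q) t = 0"
    proof (rule dig_initial_zero(2)[OF _ _ that(2)])
      show "P M * (1 / real Q) < 1" using Q(1,3) by (simp add: field_simps)
    qed simp
    ultimately show ?thesis by (simp add: D_def)
  qed
  have D_sum: "(\<Sum>t<m * p. of_int (D l t) / P (Suc t)) = 0" if "l < p" for l
  proof -
    have x01: "x l \<in> {0..<1}" "1 / real Q \<in> {0..<1}" using x_in[OF that] q_in small_in_unit_interval by blast+
    have "(\<Sum>t<m * p. of_int (D l t) / P (Suc t)) = (\<Sum>t<m * p. of_int (dig (x l) t) / P (Suc t))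
        - of_int (c l) * (\<Sum>t<m * p. of_int (dig (1 / real Q) t) / P (Suc t))"
      by (simp add: D_def sum_subtractf diff_divide_distrib sum_distrib_left del: P_Suc)
    also have "\<dots> = x l * (1 - 1 / \<delta> ^ m) - of_int (c l) * (1 / real Q * (1 - 1 / \<delta> ^ m))"
      using periodic_expansion[OF x01(1) per] periodic_expansion[OF x01(2) per] that by simp
    also have "\<dots> = 0" by (simp add: x_def)
    finally show ?thesis .
  qed
  have P_shift: "P (Suc (M + j)) = \<delta> ^ Suc N * P (Suc j)" "P (Suc (N * p + j)) = \<delta> ^ N * P (Suc j)" for j
    using P_add_mult_p[of "Suc j" "Suc N"] P_add_mult_p[of "Suc j" N]
    unfolding M_def by (simp_all only: add_Suc add.commute)
  have low: "\<delta> / P (Suc l) = (\<Sum>j<n. of_int (- D l (M + j)) / P (Suc j))" if "l < p" for l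
  proof -
    have split: "sum f {..<M + n} = sum f {..<M} + (\<Sum>j<n. f (M + j))" for f :: "nat \<Rightarrow> real"
      by (induction n) (simp_all add: add.assoc)
    have "(\<Sum>t<M. of_int (D l t) / P (Suc t)) = (\<Sum>t<M. if t = N * p + l then 1 / P (Suc (N * p + l)) else 0)"
      by (intro sum.cong) (auto simp: D_initial[OF that] simp del: P_Suc)
    also have "\<dots> = 1 / (\<delta> ^ N * P (Suc l))" using NM[OF that] by (simp add: P_shift(2) del: P_Suc)
    finally have "0 = 1 / (\<delta> ^ N * P (Suc l)) + (\<Sum>j<n. of_int (D l (M + j)) / (\<delta> ^ Suc N * P (Suc j)))"
      using D_sum[OF that] unfolding n(1) split P_shift(1) by simp
    then have "0 = \<delta> ^ Suc N * (1 / (\<delta> ^ N * P (Suc l)) + (\<Sum>j<n. of_int (D l (M + j)) / (\<delta> ^ Suc N * P (Suc j))))"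
      by simp
    also have "\<dots> = \<delta> / P (Suc l) + (\<Sum>j<n. of_int (D l (M + j)) / P (Suc j))"
      by (simp add: distrib_left sum_distrib_left del: P_Suc)
    finally show ?thesis by (simp add: sum_negf del: P_Suc)
  qed
  \<comment> \<open>Matrix of multiplication by \<delta>: the rows below \<open>p\<close> come from
    \<open>low\<close>, the others are shifts.\<close>
  define C where "C i j = (if i < p then - D i (M + j) else of_bool (j = i - p))" for i j
  show ?thesis
  proof (rule algebraic_integer_of_stable_module[of n _ "\<lambda>j. of_real (1 / P (Suc j))" C 0])
    fix i assume "i < n"
    have "\<delta> * (1 / P (Suc i)) = (\<Sum>j<n. of_int (C i j) * (1 / P (Suc j)))"
    proof (cases "i < p")
      case True
      then show ?thesis using low by (simp add: C_def del: P_Suc)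
    next
      case False
      have "(\<Sum>j<n. of_int (C i j) * (1 / P (Suc j))) = (\<Sum>j<n. if j = i - p then 1 / P (Suc (i - p)) else 0)"
        using False by (intro sum.cong) (auto simp: C_def simp del: P_Suc)
      also have "\<dots> = 1 / P (Suc (i - p))" using \<open>i < n\<close> by (simp del: P_Suc)
      also have "\<dots> = \<delta> * (1 / P (Suc i))"
        using weight_step[of "i - p"] False by (simp del: P_Suc)
      finally show ?thesis by simp
    qed
    from arg_cong[OF this, of complex_of_real]
    show "complex_of_real \<delta> * of_real (1 / P (Suc i)) = (\<Sum>j<n. of_int (C i j) * of_real (1 / P (Suc j)))"
      by (simp del: P_Suc)
  qed (use n(2) b_gt_1[of 0] in auto)
qed

end

section \<open>Conjugates and units\<close>

abbreviation rat_eval :: "rat poly \<Rightarrow> complex \<Rightarrow> complex" where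
  "rat_eval f z \<equiv> poly (map_poly of_rat f) z"

abbreviation int_eval :: "int poly \<Rightarrow> complex \<Rightarrow> complex" where
  "int_eval f z \<equiv> poly (map_poly of_int f) z"

interpretation of_rat_poly_hom: map_poly_idom_hom "of_rat :: rat \<Rightarrow> complex" ..

lemma rat_eval_simps [simp]:
  "rat_eval 0 z = 0" "rat_eval 1 z = 1" "rat_eval (pCons a f) z = of_rat a + z * rat_eval f z"
  "rat_eval (f + g) z = rat_eval f z + rat_eval g z" "rat_eval (f * g) z = rat_eval f z * rat_eval g z"
  "rat_eval (- f) z = - rat_eval f z" "rat_eval (f - g) z = rat_eval f z - rat_eval g z"
  by (simp_all add: of_rat_poly_hom.hom_add of_rat_poly_hom.hom_mult of_rat_poly_hom.hom_uminus
      of_rat_poly_hom.hom_minus of_rat_hom.map_poly_pCons_hom)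

lemma int_eval_simps [simp]:
  "int_eval 0 z = 0" "int_eval 1 z = 1" "int_eval (pCons a f) z = of_int a + z * int_eval f z"
  "int_eval (f + g) z = int_eval f z + int_eval g z" "int_eval (f * g) z = int_eval f z * int_eval g z"
  "int_eval (- f) z = - int_eval f z" "int_eval (f - g) z = int_eval f z - int_eval g z"
  by (simp_all add: of_int_poly_hom.hom_add of_int_poly_hom.hom_mult of_int_poly_hom.hom_uminus
      of_int_poly_hom.hom_minus of_int_hom.map_poly_pCons_hom)

lemma int_eval_smult [simp]: "int_eval (Polynomial.smult k f) z = of_int k * int_eval f z"
  by (induction f) (simp_all add: algebra_simps)

lemma int_eval_power [simp]: "int_eval (f ^ n) z = int_eval f z ^ n"
  by (induction n) simp_all

lemma exists_min_poly_rat: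
  assumes "algebraic_integer z"
  shows "\<exists>q. is_min_poly_rat z q"
proof -
  obtain f :: "int poly" where f: "lead_coeff f = 1" "int_eval f z = 0"
    using assms by (auto simp: algebraic_integer_def)
  define g :: "rat poly" where "g = map_poly of_int f"
  have "rat_eval g z = int_eval f z" by (simp add: g_def map_poly_map_poly comp_def)
  moreover have "coeff g (degree f) = 1" using f(1) by (simp add: g_def coeff_map_poly)
  then have "g \<noteq> 0" by auto
  ultimately have "\<exists>h. h \<noteq> 0 \<and> rat_eval h z = 0" using f(2) by auto
  then obtain h where h: "h \<noteq> 0" "rat_eval h z = 0"
    "\<And>r. r \<noteq> 0 \<and> rat_eval r z = 0 \<Longrightarrow> degree h \<le> degree r"
    using ex_has_least_nat[of "\<lambda>h. h \<noteq> 0 \<and> rat_eval h z = 0" _ degree] by blast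
  define q where "q = [:inverse (lead_coeff h):] * h"
  have "rat_eval q z = 0" unfolding q_def by (simp only: rat_eval_simps h(2)) simp
  moreover have "lead_coeff q = 1" "degree q = degree h" using h(1) by (simp_all add: q_def)
  ultimately have "is_min_poly_rat z q" using h(3) by (auto simp: is_min_poly_rat_def)
  then show ?thesis by blast
qed

section \<open>Polynomial expressions in an algebraic number and their embeddings\<close>

context
  fixes z :: complex and q :: "rat poly"
  assumes q: "is_min_poly_rat z q"
begin

lemma min_poly_dvd:
  assumes "rat_eval f z = 0"
  shows "q dvd f"
proof -
  have q0: "q \<noteq> 0" "rat_eval q z = 0" using q by (auto simp: is_min_poly_rat_def)
  have "rat_eval f z = rat_eval (f div q * q + f mod q) z" by simp
  then have "rat_eval (f mod q) z = 0" using assms q0(2) by (simp only: rat_eval_simps) simp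
  then have "f mod q = 0" using degree_mod_less[OF q0(1), of f] q by (auto simp: is_min_poly_rat_def)
  then show ?thesis by (simp add: dvd_eq_mod_eq_0)
qed

text \<open>The gcd \<open>r\<close> of \<open>f\<close> and \<open>q\<close> divides
  \<open>f\<close>, so it does not vanish at \<open>z\<close>. Hence the cofactor \<open>s\<close>
  does, and minimality of the degree of \<open>q\<close> makes \<open>r\<close> constant; Bezout
  coefficients give the inverse.\<close>

lemma rat_eval_inverse:
  assumes "rat_eval f z \<noteq> 0"
  shows "\<exists>u. rat_eval u z * rat_eval f z = 1"
proof -
  define r where "r = gcd f q"
  obtain u v where uv: "u * f + v * q = r"
    using bezout_coefficients_fst_snd[of f q] unfolding r_def by blast
  obtain s where s: "q = r * s" unfolding r_def by (metis gcd_dvd2 dvdE)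
  obtain t where t: "f = r * t" unfolding r_def by (metis gcd_dvd1 dvdE)
  have q0: "q \<noteq> 0" "rat_eval q z = 0" using q by (auto simp: is_min_poly_rat_def)
  have "rat_eval r z \<noteq> 0" using assms unfolding t by auto
  then have "rat_eval s z = 0" using q0(2) unfolding s by simp
  moreover have nz: "r \<noteq> 0" "s \<noteq> 0" using q0(1) s by auto
  ultimately have "degree q \<le> degree s" using q by (auto simp: is_min_poly_rat_def)
  moreover have "degree q = degree r + degree s" unfolding s using nz by (rule degree_mult_eq)
  ultimately have "degree r = 0" by simp
  then obtain d where d: "r = [:d:]" by (rule degree_eq_zeroE)
  then have "d \<noteq> 0" using nz(1) by simp
  have "rat_eval u z * rat_eval f z = rat_eval (u * f + v * q) z" using q0(2) by simp
  also have "\<dots> = of_rat d" unfolding uv d by simp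
  finally have "rat_eval ([:inverse d:] * u) z * rat_eval f z = of_rat (inverse d) * of_rat d"
    by (simp only: rat_eval_simps) simp
  also have "\<dots> = 1" using \<open>d \<noteq> 0\<close> by (simp add: of_rat_mult[symmetric])
  finally show ?thesis by blast
qed

lemma complex_subfield_rat_eval: "complex_subfield (range (\<lambda>f. rat_eval f z))"
proof -
  have "inverse (rat_eval f z) \<in> range (\<lambda>f. rat_eval f z)" for f
  proof (cases "rat_eval f z = 0")
    case True
    then show ?thesis by (auto intro: range_eqI[of _ _ 0])
  next
    case False
    then obtain u where "rat_eval u z * rat_eval f z = 1" using rat_eval_inverse by blast
    then have "inverse (rat_eval f z) = rat_eval u z" by (metis inverse_unique mult.commute)
    then show ?thesis by blast
  qed
  moreover have "1 \<in> range (\<lambda>f. rat_eval f z)" by (rule range_eqI[of _ _ 1]) simp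
  ultimately show ?thesis unfolding complex_subfield_def
    by (auto simp: rat_eval_simps(4,5,6)[symmetric] simp del: rat_eval_simps(4,5,6))
qed

lemma rat_adjoin_subset_rat_eval: "rat_adjoin z \<subseteq> range (\<lambda>f. rat_eval f z)"
  by (rule rat_adjoin_minimal[OF complex_subfield_rat_eval])
    (auto intro!: range_eqI[of _ _ "[:0, 1:]"])

lemma conjugate_embedding:
  assumes w: "rat_eval q w = 0"
  shows "\<exists>\<psi>. field_embedding (rat_adjoin z) \<psi> \<and> \<psi> z = w"
proof -
  \<comment> \<open>Evaluation at \<open>w\<close> of any polynomial representing \<open>a\<close>.
    Two representatives differ by a multiple of \<open>q\<close>, which vanishes at
    \<open>w\<close>. Values outside the range of evaluation at \<open>z\<close> are
    arbitrary.\<close>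
  define \<psi> where "\<psi> a = rat_eval (SOME f. rat_eval f z = a) w" for a
  have \<psi>: "\<psi> (rat_eval f z) = rat_eval f w" for f
  proof -
    define g where "g = (SOME g. rat_eval g z = rat_eval f z)"
    have "rat_eval g z = rat_eval f z"
      unfolding g_def by (rule someI[of "\<lambda>g. rat_eval g z = rat_eval f z"]) simp
    then obtain h where "g - f = q * h" using min_poly_dvd[of "g - f"] by (auto elim: dvdE)
    then have "rat_eval (g - f) w = 0" using w by simp
    then show ?thesis by (simp add: \<psi>_def g_def)
  qed
  have "field_embedding (rat_adjoin z) \<psi>"
    unfolding field_embedding_def
  proof (intro conjI ballI)
    show "\<psi> 1 = 1" using \<psi>[of 1] by simp
    fix a b assume "a \<in> rat_adjoin z" "b \<in> rat_adjoin z"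
    then obtain f g where fg: "a = rat_eval f z" "b = rat_eval g z"
      using rat_adjoin_subset_rat_eval by blast
    show "\<psi> (a + b) = \<psi> a + \<psi> b" "\<psi> (a * b) = \<psi> a * \<psi> b"
      using \<psi>[of "f + g"] \<psi>[of "f * g"] by (simp_all add: fg \<psi>)
  qed
  moreover have "\<psi> z = w" using \<psi>[of "[:0, 1:]"] by simp
  ultimately show ?thesis by blast
qed

end

section \<open>Denominators, constant coefficients and inverses\<close>

lemma clear_denominators: "\<exists>d::nat. d > 0 \<and> of_nat d * rat_eval f z \<in> range (\<lambda>g. int_eval g z)"
proof (induction f)
  case 0
  show ?case by (intro exI[of _ 1]) (auto intro: range_eqI[of _ _ 0])
next
  case (pCons a f)
  then obtain d g where d: "d > 0" "of_nat d * rat_eval f z = int_eval g z" by blast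
  obtain k l where kl: "quotient_of a = (k, l)" by fastforce
  then have l: "l > 0" "a = of_int k / of_int l"
    by (auto simp: quotient_of_denom_pos quotient_of_div)
  then have al: "of_rat a = (of_int k / of_int l :: complex)" by (simp add: of_rat_divide)
  have "of_nat (d * nat l) * rat_eval (pCons a f) z
      = of_nat d * (of_int l * of_rat a) + of_int l * z * (of_nat d * rat_eval f z)"
    using l(1) by (simp add: algebra_simps)
  also have "\<dots> = int_eval ([:int d * k:] + [:0, l:] * g) z"
    using l(1) by (simp add: d(2) al)
  finally have "of_nat (d * nat l) * rat_eval (pCons a f) z \<in> range (\<lambda>g. int_eval g z)" by blast
  moreover have "d * nat l > 0" using d(1) l(1) by simp
  ultimately show ?case by blast
qed

lemma clear_denominators_family:
  fixes n :: nat
  assumes "\<And>i. i < n \<Longrightarrow> g i \<in> range (\<lambda>f. rat_eval f z)"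
  shows "\<exists>d::nat. d > 0 \<and> (\<forall>i<n. of_nat d * g i \<in> range (\<lambda>f. int_eval f z))"
  using assms
proof (induction n)
  case (Suc n)
  then obtain d where d: "d > 0" "\<And>i. i < n \<Longrightarrow> of_nat d * g i \<in> range (\<lambda>f. int_eval f z)"
    by (metis less_SucI)
  obtain f where "g n = rat_eval f z" using Suc.prems[of n] by auto
  then obtain e where e: "e > 0" "of_nat e * g n \<in> range (\<lambda>f. int_eval f z)"
    using clear_denominators[of f z] by auto
  have scale: "of_int k * a \<in> range (\<lambda>f. int_eval f z)" if "a \<in> range (\<lambda>f. int_eval f z)" for a k
  proof -
    from that obtain f where "a = int_eval f z" by blast
    then have "of_int k * a = int_eval (Polynomial.smult k f) z" by simp
    then show ?thesis by blast
  qed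
  have "of_nat (d * e) * g i \<in> range (\<lambda>f. int_eval f z)" if "i < Suc n" for i
  proof (cases "i = n")
    case True
    then show ?thesis using scale[OF e(2), of "int d"] by (simp add: mult.assoc)
  next
    case False
    then show ?thesis using scale[OF d(2), of i "int e"] that by (simp add: mult_ac)
  qed
  then show ?case using d(1) e(1) by (intro exI[of _ "d * e"]) auto
qed auto

text \<open>In least degree the constant coefficient is nonzero, since otherwise the variable could
  be divided out, as \<open>z \<noteq> 0\<close>.\<close>

lemma vanishing_int_poly_nonzero_constant:
  assumes "algebraic_integer z" and "z \<noteq> 0"
  shows "\<exists>a f. a \<noteq> 0 \<and> int_eval (pCons a f) z = 0"
proof -
  have "\<exists>h :: int poly. h \<noteq> 0 \<and> int_eval h z = 0"
    using assms(1) unfolding algebraic_integer_def by (metis leading_coeff_0_iff zero_neq_one)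
  then obtain h :: "int poly" where h: "h \<noteq> 0" "int_eval h z = 0"
    "\<And>r. r \<noteq> 0 \<and> int_eval r z = 0 \<Longrightarrow> degree h \<le> degree r"
    using ex_has_least_nat[of "\<lambda>h. h \<noteq> 0 \<and> int_eval h z = 0" _ degree] by blast
  obtain a f where hp: "h = pCons a f" by (cases h)
  have "a \<noteq> 0"
  proof
    assume "a = 0"
    then have "f \<noteq> 0" "int_eval f z = 0" using h(1,2) hp assms(2) by auto
    then show False using h(3)[of f] hp by simp
  qed
  then show ?thesis using h(2) hp by blast
qed

text \<open>The reversed polynomial vanishes at \<open>inverse z\<close> and is monic because
  \<open>f\<close> has constant coefficient 1.\<close>

lemma algebraic_integer_inverse:
  assumes "int_eval f z = 0" and "coeff f 0 = 1"
  shows "algebraic_integer (inverse z)"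
proof -
  have z: "z \<noteq> 0"
  proof
    assume "z = 0"
    then have "int_eval f z = of_int (coeff f 0)" by (simp add: poly_0_coeff_0 coeff_map_poly)
    then show False using assms by simp
  qed
  have "map_poly of_int (reflect_poly f) = reflect_poly (map_poly of_int f :: complex poly)"
    by (simp add: poly_eq_iff coeff_map_poly coeff_reflect_poly)
  then have "int_eval (reflect_poly f) (inverse z) = 0"
    using assms(1) z by (simp add: poly_reflect_poly_nz)
  moreover have "lead_coeff (reflect_poly f) = 1"
    using assms(2) by (simp add: coeff_reflect_poly degree_reflect_poly_eq)
  ultimately show ?thesis unfolding algebraic_integer_def by blast
qed

text \<open>Replacing \<open>a\<close> by \<open>- z * f(z)\<close> in the congruence gives a
  polynomial vanishing at \<open>z\<close> with constant coefficient 1; here \<open>m > 0\<close>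
  keeps \<open>z ^ m\<close> out of that coefficient.\<close>

lemma algebraic_integer_inverse_of_power_congruence:
  assumes "int_eval (pCons a f) z = 0" and "m > 0" and "z ^ m - 1 = of_int a * int_eval g z"
  shows "algebraic_integer (inverse z)"
proof (rule algebraic_integer_inverse)
  define h where "h = 1 - [:0, 1:] ^ m - [:0, 1:] * f * g"
  have "int_eval h z = - (of_int a + z * int_eval f z) * int_eval g z"
    using assms(3) by (simp add: h_def algebra_simps)
  moreover have "of_int a + z * int_eval f z = 0" using assms(1) by simp
  ultimately show "int_eval h z = 0" by (simp only:) simp
  show "coeff h 0 = 1" using assms(2) by (simp add: h_def coeff_0_power)
qed

section \<open>Conjugates of \<delta> and the unit property\<close>

context periodic_base
begin

text \<open>A conjugate is the image of \<delta> under an embedding, and one of modulus above 1 must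
  be \<delta> itself.\<close>

lemma conjugate_norm_le_1:
  assumes "w \<in> conjugates (of_real \<delta>)" and "w \<noteq> of_real \<delta>"
  shows "norm w \<le> 1"
proof -
  obtain q where "is_min_poly_rat (of_real \<delta>) q" "rat_eval q w = 0"
    using assms(1) by (auto simp: conjugates_def)
  then obtain \<psi> where "field_embedding (rat_adjoin (of_real \<delta>)) \<psi>" "\<psi> (of_real \<delta>) = w"
    using conjugate_embedding by blast
  then show ?thesis using expanding_embedding_fixes_delta[of \<psi>] assms(2) by force
qed

text \<open>Expanding \<open>1 / Q\<close> for \<open>Q\<close> divisible by the constant coefficient \<open>a\<close> of an integer polynomial
  vanishing at \<open>\<delta>\<close>, and by denominators of the weights, shows that some power of \<open>\<delta>\<close> is \<open>1\<close> modulo \<open>a\<close>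
  in \<open>\<int>[\<delta>]\<close>, whereas \<open>\<delta>\<close> divides \<open>a\<close> there.\<close>

lemma delta_algebraic_unit: "algebraic_unit (of_real \<delta>)"
proof -
  define z where "z = complex_of_real \<delta>"
  have z0: "z \<noteq> 0" by (simp add: z_def)
  let ?Z = "range (\<lambda>f. int_eval f z)"
  have Z_add: "x + y \<in> ?Z" and Z_mult: "x * y \<in> ?Z" if "x \<in> ?Z" "y \<in> ?Z" for x y
    using that by (auto simp: int_eval_simps(4,5)[symmetric] simp del: int_eval_simps(4,5))
  have Z_int: "of_int k \<in> ?Z" for k by (rule range_eqI[of _ _ "[:k:]"]) simp
  have Z_sum: "sum h I \<in> ?Z" if "\<And>i. i \<in> I \<Longrightarrow> h i \<in> ?Z" for h and I :: "nat set"
    using that Z_int[of 0] by (induction I rule: infinite_finite_induct) (auto intro!: Z_add simp del: int_eval_simps)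
  have Z_power: "z ^ k \<in> ?Z" for k by (rule range_eqI[of _ _ "[:0, 1:] ^ k"]) simp
  have int: "algebraic_integer z" unfolding z_def by (rule delta_algebraic_integer)
  obtain q where q: "is_min_poly_rat z q" using exists_min_poly_rat[OF int] by blast
  obtain a f where af: "a \<noteq> 0" "int_eval (pCons a f) z = 0"
    using vanishing_int_poly_nonzero_constant[OF int z0] by blast
  define g where "g i = z / of_real (P (Suc i))" for i
  note K = complex_subfield_rat_adjoin[of z]
  have "g i \<in> range (\<lambda>f. rat_eval f z)" for i
  proof -
    have "g i = z * (1 / of_real (P (Suc i)))" by (simp add: g_def del: P_Suc)
    also have "\<dots> \<in> rat_adjoin z"
      using inverse_P_in_field[OF K, of "Suc i"] generator_in_rat_adjoin[of z]
      by (intro complex_subfield_mult[OF K]) (simp_all add: z_def del: P_Suc)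
    finally show ?thesis using rat_adjoin_subset_rat_eval[OF q] by blast
  qed
  then obtain d where d: "d > 0" "\<And>i. i < p \<Longrightarrow> of_nat d * g i \<in> ?Z"
    using clear_denominators_family[of p g z] by blast
  obtain u :: nat where u: "1 / \<gamma> < real u" using reals_Archimedean2 by blast
  have "0 < 1 / \<gamma>" using gamma by simp
  then have u0: "u > 0" using u by (cases u) auto
  \<comment> \<open>Here \<open>d\<close> clears the denominators of the \<open>g i\<close>,
    \<open>\<bar>a\<bar>\<close> supplies the modulus of the congruence, and \<open>u\<close> makes
    \<open>1 / Q\<close> small.\<close>
  define Q where "Q = d * nat \<bar>a\<bar> * u"
  have "1 * u \<le> Q" unfolding Q_def using d(1) af(1) by (intro mult_le_mono1) (simp add: Suc_le_eq)
  then have "1 / \<gamma> < real Q" using u by simp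
  then have Q: "1 / real Q < \<gamma>" "Q > 0" using gamma u0 \<open>1 * u \<le> Q\<close> by (auto simp: field_simps)
  then have x: "1 / real Q \<in> {0<..<\<gamma>} \<inter> \<rat>" by simp
  then obtain m where m: "m > 0" "has_period (1 / real Q) (m * p)"
    using common_period[of "{1 / real Q}"] by auto
  define T where "T = (\<Sum>t<m * p. of_int (dig (1 / real Q) t) * (of_nat d * (z ^ m / of_real (P (Suc t)))))"
  have weight: "of_nat d * (z ^ m / of_real (P (Suc t))) \<in> ?Z" if t: "t < m * p" for t
  proof -
    define i j where "i = t mod p" and "j = t div p"
    have i: "i < p" and j: "j < m" and tij: "Suc t = Suc i + j * p"
      using p_pos t by (auto simp: i_def j_def less_mult_imp_div_less)
    \<comment> \<open>As \<open>j < m\<close>, one factor \<open>z\<close> is available for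
      \<open>g i\<close> after \<open>z ^ j\<close> cancels against \<open>P (Suc t)\<close>, and
      the remaining exponent is nonnegative.\<close>
    have "m = (m - 1 - j) + 1 + j" using j by simp
    then have "z ^ m = z ^ (m - 1 - j) * z * z ^ j" by (metis power_add power_one_right)
    then have "of_nat d * (z ^ m / of_real (P (Suc t))) = z ^ (m - 1 - j) * (of_nat d * g i)"
      unfolding tij P_add_mult_p g_def using z0 by (simp add: z_def del: P_Suc)
    then show ?thesis using Z_mult[OF Z_power d(2)[OF i]] by simp
  qed
  have "T \<in> ?Z" unfolding T_def by (intro Z_sum Z_mult[OF Z_int weight]) simp
  then have "of_int (sgn a * int u) * T \<in> ?Z" by (intro Z_mult Z_int)
  then obtain h where h: "of_int (sgn a * int u) * T = int_eval h z" by blast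
  \<comment> \<open>The expansion of \<open>1 / Q\<close> is multiplied by \<open>Q * z ^ m\<close>;
    the sign of \<open>a\<close> is absorbed into the cofactor afterwards.\<close>
  have "z ^ m - 1 = of_nat Q * z ^ m * (of_real (1 / real Q) * (1 - (1 / z) ^ m))"
    using Q(2) z0 by (simp add: field_simps)
  also have "\<dots> = of_nat Q * z ^ m * (\<Sum>t<m * p. of_int (dig (1 / real Q) t) * (1 / complex_of_real (P (Suc t))))"
    using periodic_expansion_complex[OF x m(2)] by (simp only: z_def)
  also have "\<dots> = of_nat (nat \<bar>a\<bar> * u) * T"
    unfolding T_def Q_def by (simp add: sum_distrib_left mult_ac del: P_Suc)
  also have "\<dots> = of_int a * (of_int (sgn a * int u) * T)"
  proof -
    have "int (nat \<bar>a\<bar> * u) = a * (sgn a * int u)" by (cases a "0 :: int" rule: linorder_cases) simp_all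
    then have "(of_nat (nat \<bar>a\<bar> * u) :: complex) = of_int a * of_int (sgn a * int u)"
      by (metis of_int_mult of_int_of_nat_eq)
    then show ?thesis by (simp only: mult.assoc)
  qed
  finally have "z ^ m - 1 = of_int a * int_eval h z" unfolding h .
  then have "algebraic_integer (inverse z)"
    by (rule algebraic_integer_inverse_of_power_congruence[OF af(2) m(1)])
  then show ?thesis using int z0 by (simp add: algebraic_unit_def z_def)
qed

text \<open>The alternative is decided by whether some other conjugate lies on the unit
  circle.\<close>

lemma delta_pisot_or_salem_unit: "pisot_unit \<delta> \<or> salem_unit \<delta>"
  unfolding pisot_unit_def salem_unit_def pisot_def salem_def
  using conjugate_norm_le_1 delta_gt_1 delta_algebraic_integer delta_algebraic_unit
  by (meson order_le_less)

end

theorem theoremB: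
  fixes p :: nat and beta :: "nat \<Rightarrow> real"
  assumes "alt_base p beta"
    and "property_PP p beta"
  defines "\<delta> \<equiv> (\<Prod>i=1..p. beta i)"
  shows "(pisot_unit \<delta> \<or> salem_unit \<delta>)
    \<and> (\<forall>i\<in>{1..p}. complex_of_real (beta i) \<in> rat_adjoin (complex_of_real \<delta>))
    \<and> (\<forall>\<psi>. field_embedding (rat_adjoin (complex_of_real \<delta>)) \<psi>
            \<and> (\<exists>a\<in>rat_adjoin (complex_of_real \<delta>). \<psi> a \<noteq> a)
         \<longrightarrow> \<not> (\<forall>i\<in>{1..p}. \<psi> (complex_of_real (beta i)) \<in> \<real>
                              \<and> Re (\<psi> (complex_of_real (beta i))) > 0))"
proof -
  interpret alternate_base p beta by unfold_locales fact
  obtain \<gamma> where "\<gamma> > 0" and \<gamma>: "\<And>x. x \<in> {0..<\<gamma>} \<inter> \<rat> \<Longrightarrow> purely_periodic_expansion p beta x"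
    using assms(2) by (auto simp: property_PP_def)
  \<comment> \<open>Truncating at 1 supplies the upper bound required by the locale.\<close>
  then interpret periodic_base p beta "min \<gamma> 1"
    by unfold_locales auto
  have "\<delta> = P p" unfolding \<delta>_def delta_eq ..
  then show ?thesis
    using delta_pisot_or_salem_unit beta_in_rat_adjoin embedding_not_positive by blast
qed

end
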